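(* Let $L=\frac{1-\log 2}{\log 2}$, let $\epsilon>0$ be arbitrarily small, and let $u=\log x/\log y$. Suppose $x,y\to\infty$ in such a way that $u<(L-\epsilon)\log_2 y$. Then $$A(x,y)=o(\Psi(x,y)),$$ i.e. $A(x,y)/\Psi(x,y)\to 0$.
   Context: For $x\ge 1$ and $y\ge 2$, $S(x,y)=\{n\le x: P(n)\le y\}$, where $P(n)$ is the largest prime factor of $n\ge2$ and $P(1)=1$; $\Psi(x,y)=|S(x,y)|$; and $A(x,y)=\#\{ab:\ a,b\in S(\sqrt{x},y)\}$. $\log_2 y=\log\log y$. *)

theory Defs
  imports Complex_Main "HOL-Computational_Algebra.Primes"
begin

text \<open>The value at \<open>0\<close> is irrelevant: the function is only used for positive integers.\<close>

definition largest_prime_factor :: "nat \<Rightarrow> nat" where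
  "largest_prime_factor n = (if n \<ge> 2 then Max (prime_factors n) else 1)"

definition smooth_set :: "real \<Rightarrow> real \<Rightarrow> nat set" where
  "smooth_set x y = {n. n \<ge> 1 \<and> real n \<le> x \<and> real (largest_prime_factor n) \<le> y}"

definition smooth_count :: "real \<Rightarrow> real \<Rightarrow> nat" where
  "smooth_count x y = card (smooth_set x y)"

definition smooth_product_count :: "real \<Rightarrow> real \<Rightarrow> nat" where
  "smooth_product_count x y =
     card {a * b | a b. a \<in> smooth_set (sqrt x) y \<and> b \<in> smooth_set (sqrt x) y}"

definition critical_const :: real where
  "critical_const = (1 - ln 2) / ln 2"

text \<open>
  The filter for \<open>x, y \<rightarrow> \<infinity>\<close> jointly (both independently large), restricted to the pairs with
  \<open>u < (L - \<epsilon>) log log y\<close>, where \<open>u = log x / log y\<close>. A property holds eventually along this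
  filter iff it holds for all such pairs with \<open>x\<close> and \<open>y\<close> both exceeding some bound.
\<close>

definition smooth_range :: "real \<Rightarrow> (real \<times> real) filter" where
  "smooth_range \<epsilon> =
     inf (at_top \<times>\<^sub>F at_top)
         (principal {(x, y). ln x / ln y < (critical_const - \<epsilon>) * ln (ln y)})"

end

theory Submission
  imports Defs "HOL-Analysis.Harmonic_Numbers" "HOL-Real_Asymp.Real_Asymp"
begin

text \<open>
  Write \<open>t = log log y\<close> and let \<open>\<Omega>\<close> count prime factors with multiplicity. All but \<open>o(\<Psi>(x, y))\<close> of the
  smooth numbers up to \<open>x\<close> have \<open>\<Omega>(n) \<le> K\<close> with \<open>K\<close> slightly larger than \<open>t + u\<close>, whereas a product of two typical
  elements of \<open>S(\<surd>x, y)\<close> has about \<open>2 t + u\<close> prime factors. The products with \<open>\<Omega>(a b) \<le> K\<close> number at most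
  \<open>2\<^sup>K F\<^sup>2\<close>, where \<open>F\<close> is the sum of \<open>2\<close> to the power \<open>- \<Omega>(a)\<close> over \<open>S(\<surd>x, y)\<close>. Since \<open>n\<close> has at most
  \<open>2\<close> to the power \<open>\<Omega>(n)\<close> divisors, \<open>F\<^sup>2\<close> is bounded by \<open>\<Psi>(x, y)\<close>, and inserting \<open>log a = \<Sum> log p\<close> into both
  factors gains \<open>log y\<close>. Then \<open>2\<^sup>K < (log y)\<^bsup>1 - \<delta>\<^esup>\<close> is exactly the condition \<open>u < (L - \<epsilon>) t\<close>.

  No asymptotic formula for \<open>\<Psi>\<close> is needed: every count is compared with \<open>\<Psi>(x, y)\<close> itself by
  multiplying smooth numbers by primes \<open>q \<le> y\<close>, i.e. by double counting \<open>\<Sum> \<Psi>(x / q, y)\<close>. The comparisons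
  are phrased through the sums of \<open>min(A, x / m)\<close> over \<open>m \<in> S(x, y)\<close>, which dominate \<open>A \<Psi>(x / A, y)\<close>.
\<close>

section \<open>Estimates of Chebyshev and Mertens\<close>

text \<open>The obstacle is that double counting is lossy: \<open>truncated_sum y x y\<close> is
  bounded only by \<open>2 + C * ln x\<close> times \<open>smooth_count x y\<close>, a factor of
  order \<open>t * exp t\<close>, whereas a Chernoff bound for \<open>(1 + d) * t\<close> prime
  factors saves only \<open>exp (- e' * t)\<close> with a small \<open>e'\<close>. Hence the prime
  factors of \<open>n\<close> are split at \<open>z = y powr (1 / (10 * t))\<close> and
  \<open>v = y powr (1 - d)\<close>. Above \<open>v\<close> there are at most
  \<open>u / (1 - d)\<close> of them. Between \<open>z\<close> and \<open>v\<close> the reciprocals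
  of the primes sum only to about \<open>ln t\<close>, so \<open>d * t\<close> such factors occur
  with superexponentially small frequency, which absorbs any power of \<open>ln y\<close>. Below
  \<open>z\<close> the cofactor of the small part has no prime up to \<open>z\<close>; such numbers
  have density about \<open>1 / ln z\<close>, which repays the lost logarithm up to powers of
  \<open>t\<close>. A small part exceeding \<open>y\<close> is treated apart: it forces almost
  \<open>10 * t\<close> prime factors in a divisor up to \<open>y\<close>, and this outweighs the
  loss directly.\<close>

definition primes_between :: "real \<Rightarrow> real \<Rightarrow> nat set" where
  "primes_between a b = {p. prime p \<and> a < real p \<and> real p \<le> b}"

lemma finite_primes_between [simp]: "finite (primes_between a b)"
proof (rule finite_subset)
  show "primes_between a b \<subseteq> {..nat \<lfloor>b\<rfloor>}"
    by (auto simp: primes_between_def le_nat_floor)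
qed simp

lemma primes_between_gt_1: "p \<in> primes_between a b \<Longrightarrow> real p \<ge> 2"
  by (auto simp: primes_between_def dest: prime_ge_2_nat)

lemma primes_between_empty: "b < 2 \<Longrightarrow> primes_between a b = {}"
  by (auto simp: primes_between_def dest!: prime_ge_2_nat)

lemma primes_between_split:
  assumes "a \<le> b" "b \<le> c"
  shows "primes_between a c = primes_between a b \<union> primes_between b c"
        "primes_between a b \<inter> primes_between b c = {}"
  using assms by (auto simp: primes_between_def)

lemma sum_primes_between_split:
  assumes "a \<le> b" "b \<le> c"
  shows "(\<Sum>p\<in>primes_between a c. f p) = (\<Sum>p\<in>primes_between a b. f p) + (\<Sum>p\<in>primes_between b c. (f p :: real))"
  using primes_between_split[OF assms] by (simp add: sum.union_disjoint)

lemma primes_between_floor: "b \<ge> 0 \<Longrightarrow> primes_between a (real (nat \<lfloor>b\<rfloor>)) = primes_between a b"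
  unfolding primes_between_def
  by (metis (no_types, lifting) le_nat_floor of_nat_floor of_nat_le_iff order_trans)

text \<open>A prime in \<open>(n, 2 * n]\<close> divides \<open>fact (2 * n)\<close> but not
  \<open>fact n\<close>, hence the binomial coefficient. Distinct primes are coprime, so their
  product divides it as well.\<close>

lemma prod_primes_dvd_binomial: "\<Prod>(primes_between (real n) (real (2 * n))) dvd (2 * n choose n)"
proof -
  have "\<Prod>A dvd (2 * n choose n)" if "finite A" "A \<subseteq> primes_between (real n) (real (2 * n))" for A
    using that
  proof (induction A rule: finite_induct)
    case (insert p A)
    then have p: "prime p" "n < p" "p \<le> 2 * n"
      by (auto simp: primes_between_def)
    have "p dvd fact n * fact n * (2 * n choose n)"
      using p binomial_fact_lemma[of n "2 * n"] by (simp add: prime_dvd_fact_iff)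
    then have "p dvd (2 * n choose n)"
      using p by (simp add: prime_dvd_mult_iff prime_dvd_fact_iff)
    moreover have "coprime p (\<Prod>A)"
      using insert p by (intro prod_coprime_right primes_coprime) (auto simp: primes_between_def)
    ultimately show ?case
      using insert by (simp add: divides_mult)
  qed simp
  then show ?thesis by simp
qed

lemma theta_doubling:
  "(\<Sum>p\<in>primes_between (real n) (real (2 * n)). ln (real p)) \<le> real n * ln 4"
proof -
  have "real (\<Prod>(primes_between (real n) (real (2 * n)))) \<le> real (2 * n choose n)"
    by (intro of_nat_mono dvd_imp_le prod_primes_dvd_binomial) simp
  also have "\<dots> \<le> 2 ^ (2 * n)"
    using binomial_le_pow2[of "2 * n" n] by (metis of_nat_le_iff of_nat_numeral of_nat_power)
  finally have "ln (real (\<Prod>(primes_between (real n) (real (2 * n))))) \<le> ln (2 ^ (2 * n))"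
    by (intro ln_mono) (auto intro!: prod_pos simp: primes_between_def prime_gt_0_nat)
  also have "ln ((2::real) ^ (2 * n)) = real n * ln 4"
    by (simp add: power_mult ln_realpow)
  finally show ?thesis
    by (subst (asm) of_nat_prod, subst (asm) ln_prod) (auto dest: primes_between_gt_1)
qed

lemma theta_le_nat: "(\<Sum>p\<in>primes_between 0 (real n). ln (real p)) \<le> 6 * real n"
proof (induction n rule: less_induct)
  case (less n)
  show ?case
  proof (cases "n < 2")
    case True
    then show ?thesis by (simp add: primes_between_empty)
  next
    case False
    \<comment> \<open>Rounding the half up gives \<open>n <= 2 * m\<close>. The constant pays for
      the overshoot: \<open>6 * m + 2 * m <= 4 * n + 4 <= 6 * n\<close> for
      \<open>n >= 2\<close>.\<close>
    define m where "m = (n + 1) div 2"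
    have m: "m < n" "n \<le> 2 * m" "2 * m \<le> n + 1" using False by (auto simp: m_def)
    have "(\<Sum>p\<in>primes_between 0 (real n). ln (real p)) \<le> (\<Sum>p\<in>primes_between 0 (real (2 * m)). ln (real p))"
      using m by (intro sum_mono2 finite_primes_between)
        (auto simp: primes_between_def ln_ge_zero_iff dest: prime_gt_0_nat)
    also have "\<dots> \<le> 6 * real m + real m * ln 4"
      using less.IH[OF m(1)] theta_doubling[of m] by (subst sum_primes_between_split[of 0 "real m"]) auto
    also have "ln (4::real) \<le> 2"
      using ln_2_less_1 ln_realpow[of 2 2] by simp
    also have "6 * real m + real m * 2 \<le> 6 * real n"
      using m False by (simp add: field_simps)
    finally show ?thesis by (simp add: mult_left_mono)
  qed
qed

lemma theta_le: "t \<ge> 0 \<Longrightarrow> (\<Sum>p\<in>primes_between 0 t. ln (real p)) \<le> 6 * t"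
  using theta_le_nat[of "nat \<lfloor>t\<rfloor>"] of_nat_floor[of t] primes_between_floor[of t 0]
  by (metis mult_left_mono order_trans zero_le_numeral)

text \<open>Both bounds come from the recursion \<open>S n = n div p + S (n div p)\<close>, since
  \<open>p * k\<close> has multiplicity one more than \<open>k\<close>. Induction on it replaces the
  sum over prime powers in Legendre's formula.\<close>

lemma multiplicity_sum_bounds:
  assumes p: "prime p"
  shows "real (n div p) \<le> (\<Sum>m=1..n. real (multiplicity p m))"
    and "(\<Sum>m=1..n. real (multiplicity p m)) * (real p - 1) \<le> real n"
proof -
  have *: "(\<Sum>m=1..n. real (multiplicity p m)) =
      real (n div p) + (\<Sum>m=1..n div p. real (multiplicity p m))" for n
  proof -
    have "(\<Sum>m=1..n. real (multiplicity p m)) = (\<Sum>m\<in>(\<lambda>k. p * k) ` {1..n div p}. real (multiplicity p m))"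
    proof (rule sum.mono_neutral_right)
      show "(\<lambda>k. p * k) ` {1..n div p} \<subseteq> {1..n}"
        using prime_gt_0_nat[OF p] by (auto simp: less_eq_div_iff_mult_less_eq mult.commute Suc_le_eq)
      show "\<forall>i\<in>{1..n} - (\<lambda>k. p * k) ` {1..n div p}. real (multiplicity p i) = 0"
      proof
        fix i assume i: "i \<in> {1..n} - (\<lambda>k. p * k) ` {1..n div p}"
        have "\<not> p dvd i"
        proof
          assume "p dvd i"
          then obtain k where k: "i = p * k" by auto
          with i prime_gt_0_nat[OF p] have "k \<in> {1..n div p}"
            by (auto simp: less_eq_div_iff_mult_less_eq mult.commute Suc_le_eq)
          with i k show False by auto
        qed
        then show "real (multiplicity p i) = 0" by (simp add: not_dvd_imp_multiplicity_0)
      qed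
    qed simp
    also have "\<dots> = (\<Sum>k=1..n div p. real (multiplicity p (p * k)))"
      using prime_gt_0_nat[OF p] by (subst sum.reindex) (auto simp: inj_on_def)
    also have "\<dots> = (\<Sum>k=1..n div p. 1 + real (multiplicity p k))"
    proof (intro sum.cong refl)
      fix k assume "k \<in> {1..n div p}"
      then have "k \<noteq> 0" by simp
      then show "real (multiplicity p (p * k)) = 1 + real (multiplicity p k)"
        using p multiplicity_times_same[of k p] prime_gt_1_nat[OF p] by auto
    qed
    finally show ?thesis by (simp add: sum.distrib)
  qed
  show "real (n div p) \<le> (\<Sum>m=1..n. real (multiplicity p m))"
    using *[of n] by (simp add: sum_nonneg)
  show "(\<Sum>m=1..n. real (multiplicity p m)) * (real p - 1) \<le> real n"
  proof (induction n rule: less_induct)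
    case (less n)
    show ?case
    proof (cases "n = 0")
      case False
      have "(\<Sum>m=1..n. real (multiplicity p m)) * (real p - 1) \<le> real (n div p) * (real p - 1) + real (n div p)"
        using less.IH[of "n div p"] False prime_gt_1_nat[OF p] by (subst *) (simp add: algebra_simps)
      also have "\<dots> = real (n div p * p)" by (simp add: algebra_simps)
      also have "\<dots> \<le> real n" by (intro of_nat_mono) simp
      finally show ?thesis .
    qed simp
  qed
qed

lemma ln_eq_sum_multiplicity:
  assumes "m \<ge> 1" "\<And>p. prime p \<Longrightarrow> p dvd m \<Longrightarrow> real p \<le> b"
  shows "ln (real m) = (\<Sum>p\<in>primes_between 0 b. real (multiplicity p m) * ln (real p))"
proof -
  have "ln (real m) = ln (\<Prod>p\<in>prime_factors m. real p ^ multiplicity p m)"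
    using assms prime_factorization_nat[of m] by (metis (no_types, lifting) of_nat_power of_nat_prod prod.cong not_one_le_zero neq0_conv)
  also have "\<dots> = (\<Sum>p\<in>prime_factors m. real (multiplicity p m) * ln (real p))"
    by (subst ln_prod) (auto simp: ln_realpow intro!: sum.cong dest!: in_prime_factors_imp_prime prime_gt_0_nat)
  also have "\<dots> = (\<Sum>p\<in>primes_between 0 b. real (multiplicity p m) * ln (real p))"
  proof (rule sum.mono_neutral_left)
    show "prime_factors m \<subseteq> primes_between 0 b"
      using assms by (auto simp: primes_between_def in_prime_factors_iff prime_gt_0_nat)
    show "\<forall>i\<in>primes_between 0 b - prime_factors m. real (multiplicity i m) * ln (real i) = 0"
      using assms by (auto simp: primes_between_def in_prime_factors_iff not_dvd_imp_multiplicity_0)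
  qed simp
  finally show ?thesis .
qed

lemma sum_ln_eq:
  "(\<Sum>m=1..n. ln (real m)) =
     (\<Sum>p\<in>primes_between 0 (real n). ln (real p) * (\<Sum>m=1..n. real (multiplicity p m)))"
proof -
  have "(\<Sum>m=1..n. ln (real m)) = (\<Sum>m=1..n. \<Sum>p\<in>primes_between 0 (real n). real (multiplicity p m) * ln (real p))"
    by (intro sum.cong ln_eq_sum_multiplicity) (auto dest!: dvd_imp_le)
  then show ?thesis
    by (subst (asm) sum.swap) (simp add: sum_distrib_left mult.commute)
qed

lemma sum_ln_bounds:
  assumes "n \<ge> 1"
  shows "(\<Sum>m=1..n. ln (real m)) \<le> real n * ln (real n)"
    and "real n * ln (real n) - real n \<le> (\<Sum>m=1..n. ln (real m))"
proof -
  have "(\<Sum>m=1..n. ln (real m)) \<le> (\<Sum>m=1..n. ln (real n))"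
    by (intro sum_mono) auto
  then show "(\<Sum>m=1..n. ln (real m)) \<le> real n * ln (real n)" by simp
  show "real n * ln (real n) - real n \<le> (\<Sum>m=1..n. ln (real m))"
    using assms
  proof (induction n rule: dec_induct)
    case (step n)
    have "ln (real (Suc n) / real n) \<le> real (Suc n) / real n - 1"
      using step by (intro ln_le_minus_one) auto
    then have "real n * (ln (real (Suc n)) - ln (real n)) \<le> 1"
      using step by (simp add: ln_div field_simps)
    with step show ?case by (simp add: algebra_simps)
  qed simp
qed

lemma sum_ln_over_prime_mult_pred_le:
  "(\<Sum>p\<in>primes_between 0 (real n). ln (real p) / (real p * (real p - 1))) \<le> 2"
proof -
  \<comment> \<open>A telescoping majorant: \<open>(ln n + 2) / n\<close> is slightly more than the
    integral of \<open>ln s / s ^ 2\<close> from \<open>n\<close> to infinity, and the constant 2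
    makes the claim an equality at \<open>n = 1\<close>.\<close>
  have *: "(\<Sum>m=2..n. ln (real m) / (real m * (real m - 1))) \<le> 2 - (ln (real n) + 2) / real n" if "n \<ge> 1"
    using that
  proof (induction n rule: dec_induct)
    case (step n)
    have n: "real n > 0" using step by simp
    have "ln (real (Suc n) / real n) \<le> real (Suc n) / real n - 1"
      using n by (intro ln_le_minus_one) auto
    then have l: "ln (1 + real n) - ln (real n) \<le> 1 / real n"
      using n by (simp add: ln_div field_simps)
    have "(\<Sum>m=2..Suc n. ln (real m) / (real m * (real m - 1))) =
          (\<Sum>m=2..n. ln (real m) / (real m * (real m - 1))) + ln (1 + real n) / ((1 + real n) * real n)"
      using step by (subst sum.cl_ivl_Suc) auto
    also have "ln (1 + real n) / ((1 + real n) * real n) \<le> (ln (real n) + 2) / real n - (ln (1 + real n) + 2) / (1 + real n)"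
    proof -
      have "(1 + real n) * (ln (1 + real n) - ln (real n)) \<le> (1 + real n) * (1 / real n)"
        using l n by (intro mult_left_mono) auto
      also have "\<dots> \<le> 2" using step by (simp add: field_simps)
      finally have "ln (1 + real n) \<le> (1 + real n) * (ln (real n) + 2) - real n * (ln (1 + real n) + 2)"
        by (simp add: algebra_simps)
      then have "ln (1 + real n) / ((1 + real n) * real n)
          \<le> ((1 + real n) * (ln (real n) + 2) - real n * (ln (1 + real n) + 2)) / ((1 + real n) * real n)"
        using n by (intro divide_right_mono) auto
      also have "\<dots> = (ln (real n) + 2) / real n - (ln (1 + real n) + 2) / (1 + real n)"
        using n by (simp add: divide_simps)
      finally show ?thesis .
    qed
    finally show ?case using step.IH by (simp add: add.commute)
  qed simp
  show ?thesis
  proof (cases "n \<ge> 1")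
    case True
    have "(\<Sum>p\<in>primes_between 0 (real n). ln (real p) / (real p * (real p - 1)))
        \<le> (\<Sum>m=2..n. ln (real m) / (real m * (real m - 1)))"
      by (intro sum_mono2) (auto simp: primes_between_def dest: prime_ge_2_nat)
    also have "\<dots> \<le> 2"
      using *[OF True] True by (smt (verit) divide_nonneg_nonneg ln_ge_zero of_nat_0_le_iff real_of_nat_ge_one_iff)
    finally show ?thesis .
  qed (simp add: primes_between_empty)
qed

text \<open>The sum of \<open>ln m\<close> for \<open>m <= n\<close> is computed in two ways. In the
  upper estimate Chebyshev's bound \<open>6 * n\<close> pays for rounding \<open>n / p\<close> down;
  in the lower one the prime powers enter through \<open>n / (p - 1)\<close> and cost only a
  convergent sum.\<close>

lemma mertens_first_nat:
  assumes "n \<ge> 1"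
  shows "\<bar>(\<Sum>p\<in>primes_between 0 (real n). ln (real p) / real p) - ln (real n)\<bar> \<le> 6"
proof -
  let ?P = "primes_between 0 (real n)"
  let ?A = "\<Sum>p\<in>?P. ln (real p) / real p"
  have n: "real n > 0" using assms by simp
  have "real n * ?A - 6 * real n \<le> (\<Sum>p\<in>?P. ln (real p) * (real n / real p)) - (\<Sum>p\<in>?P. ln (real p))"
    using theta_le[of "real n"] by (simp add: sum_distrib_left mult_ac)
  also have "\<dots> = (\<Sum>p\<in>?P. ln (real p) * (real n / real p - 1))"
    by (simp add: sum_subtractf algebra_simps)
  also have "\<dots> \<le> (\<Sum>p\<in>?P. ln (real p) * (\<Sum>m=1..n. real (multiplicity p m)))"
  proof (intro sum_mono mult_left_mono)
    fix p assume p: "p \<in> ?P"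
    then have "prime p" by (simp add: primes_between_def)
    have "real n / real p - 1 \<le> real (n div p)"
      by (smt (verit) of_nat_floor floor_divide_of_nat_eq of_int_of_nat_eq real_of_int_floor_gt_diff_one)
    also have "\<dots> \<le> (\<Sum>m=1..n. real (multiplicity p m))"
      by (rule multiplicity_sum_bounds(1)[OF \<open>prime p\<close>])
    finally show "real n / real p - 1 \<le> (\<Sum>m=1..n. real (multiplicity p m))" .
    show "ln (real p) \<ge> 0" using primes_between_gt_1[OF p] by simp
  qed
  also have "\<dots> \<le> real n * ln (real n)"
    using sum_ln_bounds(1)[OF assms] sum_ln_eq[of n] by simp
  finally have "real n * (?A - 6) \<le> real n * ln (real n)" by (simp add: algebra_simps)
  then have 1: "?A - 6 \<le> ln (real n)" using n by (simp add: mult_le_cancel_left_pos)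
  have "real n * ln (real n) - real n \<le> (\<Sum>p\<in>?P. ln (real p) * (\<Sum>m=1..n. real (multiplicity p m)))"
    using sum_ln_bounds(2)[OF assms] sum_ln_eq[of n] by simp
  also have "\<dots> \<le> (\<Sum>p\<in>?P. ln (real p) * (real n / (real p - 1)))"
  proof (intro sum_mono mult_left_mono)
    fix p assume p: "p \<in> ?P"
    then have "prime p" by (simp add: primes_between_def)
    then show "(\<Sum>m=1..n. real (multiplicity p m)) \<le> real n / (real p - 1)"
      using multiplicity_sum_bounds(2)[of p n] primes_between_gt_1[OF p] by (simp add: pos_le_divide_eq)
    show "ln (real p) \<ge> 0" using primes_between_gt_1[OF p] by simp
  qed
  also have "\<dots> = (\<Sum>p\<in>?P. real n * (ln (real p) / real p) + real n * (ln (real p) / (real p * (real p - 1))))"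
  proof (rule sum.cong)
    fix p assume p: "p \<in> ?P"
    show "ln (real p) * (real n / (real p - 1)) = real n * (ln (real p) / real p) + real n * (ln (real p) / (real p * (real p - 1)))"
      using primes_between_gt_1[OF p] by (simp add: divide_simps) (simp add: algebra_simps)
  qed simp
  also have "\<dots> = real n * (?A + (\<Sum>p\<in>?P. ln (real p) / (real p * (real p - 1))))"
    by (simp add: sum.distrib sum_distrib_left algebra_simps)
  also have "\<dots> \<le> real n * (?A + 2)"
    using sum_ln_over_prime_mult_pred_le[of n] by (intro mult_left_mono) auto
  finally have "real n * (ln (real n) - 1) \<le> real n * (?A + 2)" by (simp add: algebra_simps)
  then have "ln (real n) - 1 \<le> ?A + 2" using n by (simp add: mult_le_cancel_left_pos)
  with 1 show ?thesis by linarith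
qed

lemma mertens_first:
  assumes "t \<ge> 1"
  shows "\<bar>(\<Sum>p\<in>primes_between 0 t. ln (real p) / real p) - ln t\<bar> \<le> 7"
proof -
  define n where "n = nat \<lfloor>t\<rfloor>"
  have n: "n \<ge> 1" "real n \<le> t" "t < real n + 1"
    using assms by (auto simp: n_def le_nat_floor)
  have "ln t \<le> ln (2 * real n)" using n assms by (intro ln_mono) linarith+
  also have "\<dots> \<le> 1 + ln (real n)" using n ln_2_less_1 by (simp add: ln_mult)
  finally have "ln t \<le> 1 + ln (real n)" .
  moreover have "ln (real n) \<le> ln t" using n by (intro ln_mono) auto
  moreover have "primes_between 0 (real n) = primes_between 0 t"
    using primes_between_floor[of t 0] assms by (simp add: n_def)
  ultimately show ?thesis
    using mertens_first_nat[OF n(1)] by simp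
qed

lemma sum_ln_over_prime_between:
  assumes "1 \<le> a" "a \<le> b"
  shows "ln b - ln a - 14 \<le> (\<Sum>p\<in>primes_between a b. ln (real p) / real p)"
  using mertens_first[of a] mertens_first[of b] sum_primes_between_split[of 0 a b "\<lambda>p. ln (real p) / real p"] assms
  by simp

text \<open>Replacing \<open>ln p\<close> by \<open>ln b\<close> loses at most the factor
  \<open>ln b / ln a\<close>, so a positive proportion survives when the two are comparable. The
  absorption of primes close to \<open>y\<close> asks for no more.\<close>

lemma sum_inverse_primes_ge:
  assumes "1 \<le> a" "a \<le> b" "b > 1"
  shows "(ln b - ln a - 14) / ln b \<le> (\<Sum>p\<in>primes_between a b. 1 / real p)"
proof -
  have "(ln b - ln a - 14) / ln b \<le> (\<Sum>p\<in>primes_between a b. ln (real p) / real p) / ln b"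
    using assms by (intro divide_right_mono sum_ln_over_prime_between) auto
  also have "\<dots> = (\<Sum>p\<in>primes_between a b. ln (real p) / real p / ln b)"
    by (rule sum_divide_distrib)
  also have "\<dots> \<le> (\<Sum>p\<in>primes_between a b. 1 / real p)"
  proof (rule sum_mono)
    fix p assume p: "p \<in> primes_between a b"
    then have "ln (real p) \<le> ln b" using assms by (intro ln_mono) (auto simp: primes_between_def)
    then show "ln (real p) / real p / ln b \<le> 1 / real p"
      using primes_between_gt_1[OF p] assms by (simp add: divide_simps)
  qed
  finally show ?thesis .
qed

text \<open>By Mertens the values \<open>ln p / p\<close> over \<open>(t / exp 15, t]\<close> sum to
  at least \<open>15 - 14 = 1\<close>, and each such \<open>p\<close> exceeds
  \<open>t / exp 15\<close>. For \<open>t < exp 15\<close> the prime 2 alone suffices, as the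
  claimed bound is then at most 1/2.\<close>

lemma theta_ge: "\<exists>c>0. \<forall>t\<ge>2. c * t \<le> (\<Sum>p\<in>primes_between 0 t. ln (real p))"
proof (intro exI[of _ "1 / (2 * exp 15)"] conjI allI impI)
  fix t :: real assume t: "t \<ge> 2"
  show "1 / (2 * exp 15) * t \<le> (\<Sum>p\<in>primes_between 0 t. ln (real p))"
  proof (cases "t \<ge> exp 15")
    case True
    have "1 \<le> (\<Sum>p\<in>primes_between (t / exp 15) t. ln (real p) / real p)"
      using sum_ln_over_prime_between[of "t / exp 15" t] True t by (simp add: ln_div divide_le_eq)
    also have "\<dots> \<le> (\<Sum>p\<in>primes_between (t / exp 15) t. ln (real p) / (t / exp 15))"
    proof (intro sum_mono divide_left_mono)
      fix p assume p: "p \<in> primes_between (t / exp 15) t"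
      then show "t / exp 15 \<le> real p" "0 \<le> ln (real p)" "0 < real p * (t / exp 15)"
        using t primes_between_gt_1[OF p] by (auto simp: primes_between_def)
    qed
    also have "\<dots> = (\<Sum>p\<in>primes_between (t / exp 15) t. ln (real p)) / (t / exp 15)"
      by (rule sum_divide_distrib[symmetric])
    finally have "t / exp 15 \<le> (\<Sum>p\<in>primes_between (t / exp 15) t. ln (real p))"
      using t by (simp add: field_simps)
    also have "\<dots> \<le> (\<Sum>p\<in>primes_between 0 t. ln (real p))"
    proof (rule sum_mono2)
      show "primes_between (t / exp 15) t \<subseteq> primes_between 0 t"
        by (auto simp: primes_between_def prime_gt_0_nat)
    qed (auto dest: primes_between_gt_1)
    finally show ?thesis using t by (auto simp: field_simps)
  next
    case False
    have "1 / (2 * exp 15) * t \<le> 1 / 2" using False by (simp add: field_simps)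
    also have "\<dots> \<le> ln (real 2)" using ln2_ge_two_thirds by simp
    also have "\<dots> = (\<Sum>p\<in>{2}. ln (real p))" by simp
    also have "\<dots> \<le> (\<Sum>p\<in>primes_between 0 t. ln (real p))"
      using t by (intro sum_mono2 finite_primes_between) (auto simp: primes_between_def Suc_le_eq prime_gt_0_nat)
    finally show ?thesis .
  qed
qed auto

lemma sum_inverse_primes_le_nat:
  assumes "2 \<le> M" "M \<le> N"
  shows "(\<Sum>p\<in>primes_between (real M) (real N). 1 / real p)
     \<le> ln (ln (real N)) - ln (ln (real M)) + 14 / ln (real M)"
proof -
  define E where "E n = (\<Sum>p\<in>primes_between 0 (real n). ln (real p) / real p) - ln (real n)" for n
  have E: "\<bar>E n\<bar> \<le> 7" if "n \<ge> 1" for n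
    using mertens_first[of "real n"] that by (simp add: E_def)
  \<comment> \<open>Partial summation as an induction: since \<open>E \<le> 7\<close>, lowering \<open>1 / ln n\<close> in the boundary term only helps.\<close>
  have "(\<Sum>p\<in>primes_between (real M) (real N). 1 / real p)
     \<le> ln (ln (real N)) - ln (ln (real M)) + (E N - 7) / ln (real N) + (7 - E M) / ln (real M)"
    using assms(2,1)
  proof (induction N rule: dec_induct)
    case base
    have "primes_between (real M) (real M) = {}" by (auto simp: primes_between_def)
    then show ?case by (simp flip: add_divide_distrib)
  next
    case (step n)
    have n: "n \<ge> 2" using step by simp
    let ?s = "\<lambda>f. (\<Sum>p\<in>primes_between (real n) (real (Suc n)). f (p :: nat) :: real)"
    have *: "primes_between (real n) (real (Suc n)) \<subseteq> {Suc n}" by (auto simp: primes_between_def)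
    have lpos: "ln (real n) > 0" "ln (real (Suc n)) > 0" "ln (real n) \<le> ln (real (Suc n))" using n by auto
    have dE: "E (Suc n) - E n = ?s (\<lambda>p. ln (real p) / real p) - (ln (real (Suc n)) - ln (real n))"
      using sum_primes_between_split[of 0 "real n" "real (Suc n)" "\<lambda>p. ln (real p) / real p"] by (simp add: E_def)
    have "?s (\<lambda>p. 1 / real p) = ?s (\<lambda>p. (ln (real p) / real p) / ln (real (Suc n)))"
      using * lpos by (intro sum.cong) auto
    also have "\<dots> = (E (Suc n) - E n + (ln (real (Suc n)) - ln (real n))) / ln (real (Suc n))"
      by (subst dE) (simp add: sum_divide_distrib)
    also have "\<dots> = (E (Suc n) - 7) / ln (real (Suc n)) - (E n - 7) / ln (real (Suc n)) + (1 - ln (real n) / ln (real (Suc n)))"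
      using lpos by (simp add: field_simps)
    also have "1 - ln (real n) / ln (real (Suc n)) \<le> - ln (ln (real n) / ln (real (Suc n)))"
      using ln_le_minus_one[of "ln (real n) / ln (real (Suc n))"] lpos by simp
    also have "\<dots> = ln (ln (real (Suc n))) - ln (ln (real n))"
      using lpos by (simp add: ln_div)
    finally have le: "?s (\<lambda>p. 1 / real p) \<le> (E (Suc n) - 7) / ln (real (Suc n)) - (E n - 7) / ln (real (Suc n))
      + (ln (ln (real (Suc n))) - ln (ln (real n)))" by simp
    have "- ((E n - 7) / ln (real (Suc n))) \<le> - ((E n - 7) / ln (real n))"
    proof -
      have "(7 - E n) / ln (real (Suc n)) \<le> (7 - E n) / ln (real n)"
        using lpos E[of n] n by (intro divide_left_mono) auto
      then show ?thesis by (simp add: diff_divide_distrib)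
    qed
    with le have "?s (\<lambda>p. 1 / real p) \<le> (E (Suc n) - 7) / ln (real (Suc n)) - (E n - 7) / ln (real n)
      + (ln (ln (real (Suc n))) - ln (ln (real n)))" by simp
    then show ?case
      using step sum_primes_between_split[of "real M" "real n" "real (Suc n)" "\<lambda>p. 1 / real p"] by simp
  qed
  also have "(E N - 7) / ln (real N) \<le> 0"
    using E[of N] assms by (intro divide_nonpos_pos) auto
  also have "(7 - E M) / ln (real M) \<le> 14 / ln (real M)"
    using E[of M] assms by (intro divide_right_mono) auto
  finally show ?thesis by simp
qed

text \<open>Mertens' second estimate with leading constant exactly 1. The precision matters because
  \<open>prod_primes_le_exp\<close> exponentiates this sum, so the coefficient of
  \<open>ln (ln y)\<close> becomes an exponent of \<open>ln y\<close>.\<close>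

lemma sum_inverse_primes_le:
  assumes "2 \<le> a" "a \<le> b"
  shows "(\<Sum>p\<in>primes_between a b. 1 / real p) \<le> ln (ln b) - ln (ln a) + 30 / ln a"
proof -
  define M where "M = nat \<lfloor>a\<rfloor>"
  define N where "N = nat \<lfloor>b\<rfloor>"
  have M: "2 \<le> M" "real M \<le> a" "a < real M + 1"
    using assms by (auto simp: M_def le_nat_floor)
  have N: "M \<le> N" "real N \<le> b" using assms by (auto simp: M_def N_def intro!: nat_mono floor_mono)
  have lM: "ln (real M) \<ge> 1 / 2"
  proof -
    have "ln 2 \<le> ln (real M)" using M by (intro ln_mono) auto
    then show ?thesis using ln2_ge_two_thirds by linarith
  qed
  have "primes_between a b = primes_between (real M) (real N)"
  proof -
    have "a < real p \<longleftrightarrow> real M < real p" for p :: nat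
    proof
      assume "real M < real p"
      then have "M + 1 \<le> p" by simp
      then have "real M + 1 \<le> real p" by (metis of_nat_1 of_nat_add of_nat_le_iff)
      with M show "a < real p" by linarith
    qed (use M in linarith)
    moreover have "real p \<le> b \<longleftrightarrow> real p \<le> real N" for p
      using N le_nat_floor[of p b] by (auto simp: N_def[symmetric])
    ultimately show ?thesis by (auto simp: primes_between_def)
  qed
  then have "(\<Sum>p\<in>primes_between a b. 1 / real p) \<le> ln (ln (real N)) - ln (ln (real M)) + 14 / ln (real M)"
    using sum_inverse_primes_le_nat[OF M(1) N(1)] by simp
  moreover have "ln (ln (real N)) \<le> ln (ln b)"
    using M N assms by (intro ln_mono) (auto intro!: ln_gt_zero)
  moreover have d: "ln a \<le> ln (real M) + 1 / 2"
  proof -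
    have "ln (a / real M) \<le> a / real M - 1" using M assms by (intro ln_le_minus_one) auto
    also have "\<dots> \<le> 1 / 2" using M by (simp add: field_simps)
    finally show ?thesis using M assms by (simp add: ln_div)
  qed
  moreover have "ln (ln a) - ln (ln (real M)) \<le> (1 / 2) / ln (real M)"
  proof -
    have "ln (ln a / ln (real M)) \<le> ln a / ln (real M) - 1" using lM M assms by (intro ln_le_minus_one) auto
    also have "\<dots> \<le> (1 / 2) / ln (real M)"
      using divide_right_mono[OF d, of "ln (real M)"] lM by (simp add: add_divide_distrib)
    finally show ?thesis using M lM assms by (simp add: ln_div)
  qed
  \<comment> \<open>The 14 is inherited from integer endpoints and the 1/2 pays for passing from
    \<open>a\<close> to its integer part; \<open>ln a <= 2 * ln M\<close> then costs a factor of
    two.\<close>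
  moreover have "(14 + 1 / 2) / ln (real M) \<le> 30 / ln a"
    using d lM assms by (simp add: field_simps)
  ultimately show ?thesis by (simp add: add_divide_distrib)
qed

section \<open>Double counting of smooth numbers\<close>

text \<open>The condition on prime divisors is vacuous for \<open>n = 1\<close>, while
  \<open>largest_prime_factor 1 = 1\<close>; the two descriptions agree there because
  \<open>y >= 1\<close>.\<close>

lemma smooth_set_iff:
  assumes "y \<ge> 1"
  shows "n \<in> smooth_set x y \<longleftrightarrow> n \<ge> 1 \<and> real n \<le> x \<and> (\<forall>p. prime p \<longrightarrow> p dvd n \<longrightarrow> real p \<le> y)"
proof (cases "n \<ge> 2")
  case True
  then have ne: "prime_factors n \<noteq> {}"
    by (simp add: prime_factorization_empty_iff)
  have "real (Max (prime_factors n)) \<le> y \<longleftrightarrow> (\<forall>p\<in>prime_factors n. real p \<le> y)"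
  proof
    assume "real (Max (prime_factors n)) \<le> y"
    then show "\<forall>p\<in>prime_factors n. real p \<le> y"
      by (meson Max_ge finite_set_mset of_nat_le_iff order_trans)
  next
    assume "\<forall>p\<in>prime_factors n. real p \<le> y"
    then show "real (Max (prime_factors n)) \<le> y"
      using Max_in[OF _ ne] by auto
  qed
  then show ?thesis
    using True by (auto simp: smooth_set_def largest_prime_factor_def in_prime_factors_iff)
next
  case False
  have "real p \<le> y" if "prime p" "p dvd n" "n \<ge> 1" for p
  proof -
    have "n = 1" using False that by linarith
    with that show ?thesis by simp
  qed
  then show ?thesis
    using assms False by (auto simp: smooth_set_def largest_prime_factor_def)
qed

lemma finite_smooth_set [simp]: "finite (smooth_set x y)"
  by (rule finite_subset[of _ "{..nat \<lfloor>x\<rfloor>}"]) (auto simp: smooth_set_def le_nat_floor)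

lemma smooth_set_pos: "n \<in> smooth_set x y \<Longrightarrow> n \<ge> 1 \<and> real n \<le> x"
  by (simp add: smooth_set_def)

lemma smooth_set_empty: "x < 1 \<Longrightarrow> smooth_set x y = {}"
  by (auto simp: smooth_set_def)

lemma smooth_set_mono: "x \<le> x' \<Longrightarrow> y \<le> y' \<Longrightarrow> smooth_set x y \<subseteq> smooth_set x' y'"
  by (auto simp: smooth_set_def)

lemma smooth_count_mono: "x \<le> x' \<Longrightarrow> y \<le> y' \<Longrightarrow> smooth_count x y \<le> smooth_count x' y'"
  unfolding smooth_count_def by (intro card_mono smooth_set_mono) auto

lemma smooth_count_pos: "x \<ge> 1 \<Longrightarrow> y \<ge> 1 \<Longrightarrow> smooth_count x y > 0"
  unfolding smooth_count_def card_gt_0_iff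
  using smooth_set_iff[of y 1 x] by auto

lemma smooth_set_mult:
  assumes "y \<ge> 1" "a \<in> smooth_set X y" "b \<in> smooth_set Y y" "X * Y \<le> x"
  shows "a * b \<in> smooth_set x y"
proof -
  have "real a * real b \<le> X * Y"
    using assms by (intro mult_mono) (auto dest!: smooth_set_pos)
  then show ?thesis
    using assms by (auto simp: smooth_set_iff prime_dvd_mult_iff)
qed

lemma smooth_set_dvd:
  assumes "y \<ge> 1" "n \<in> smooth_set x y" "d dvd n"
  shows "d \<in> smooth_set x y" "n div d \<in> smooth_set (x / real d) y"
proof -
  from assms obtain e where e: "n = d * e" by auto
  have *: "n \<ge> 1" "real n \<le> x" using assms smooth_set_pos by auto
  then have d: "d \<ge> 1" "e \<ge> 1" using e by (auto simp: Suc_le_eq)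
  then have "d \<le> n" using e by simp
  then have "real d \<le> x" using * by linarith
  then show "d \<in> smooth_set x y"
    using assms d by (auto simp: smooth_set_iff)
  have "real d * real e \<le> x" using * e by simp
  then have "real e \<le> x / real d" using d by (simp add: field_simps)
  then show "n div d \<in> smooth_set (x / real d) y"
    using assms d e by (auto simp: smooth_set_iff)
qed

text \<open>Membership in \<open>smooth_set z y\<close> expresses that \<open>d\<close> is positive
  and \<open>y\<close>-smooth. The bound \<open>z\<close> is free, so \<open>d\<close> may exceed
  \<open>x\<close>, in which case both sides are empty.\<close>

lemma bij_betw_smooth_multiples:
  assumes "y \<ge> 1" "d \<in> smooth_set z y"
  shows "bij_betw (\<lambda>m. d * m) (smooth_set (x / real d) y) {n \<in> smooth_set x y. d dvd n}"
proof -
  have d: "d \<ge> 1" using assms smooth_set_pos by auto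
  show ?thesis
  proof (rule bij_betw_byWitness[where f' = "\<lambda>n. n div d"])
    have "d * m \<in> smooth_set x y" if "m \<in> smooth_set (x / real d) y" for m
    proof -
      have "d \<in> smooth_set (real d) y" using assms by (auto simp: smooth_set_iff)
      then show ?thesis using that d assms by (intro smooth_set_mult[of y d "real d" m "x / real d"]) auto
    qed
    then show "(\<lambda>m. d * m) ` smooth_set (x / real d) y \<subseteq> {n \<in> smooth_set x y. d dvd n}" by auto
    show "(\<lambda>n. n div d) ` {n \<in> smooth_set x y. d dvd n} \<subseteq> smooth_set (x / real d) y"
      using assms smooth_set_dvd by blast
  qed (use d in auto)
qed

lemma card_smooth_multiples:
  assumes "y \<ge> 1" "d \<in> smooth_set z y"
  shows "card {n \<in> smooth_set x y. d dvd n} = smooth_count (x / real d) y"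
  using bij_betw_same_card[OF bij_betw_smooth_multiples[OF assms]] by (simp add: smooth_count_def)

lemma prime_in_smooth_set: "prime p \<Longrightarrow> real p \<le> y \<Longrightarrow> p \<in> smooth_set (real p) y"
  using prime_ge_1_nat[of p]
  by (subst smooth_set_iff) (auto simp: primes_dvd_imp_eq dest: primes_dvd_imp_eq order_trans)

section \<open>Averages of \<open>smooth_count (x / q) y\<close> over primes
  \<open>q\<close>\<close>

lemma sum_ln_prime_divisors_le:
  assumes "n \<ge> 1" "finite A" "\<And>p. p \<in> A \<Longrightarrow> prime p \<and> p dvd n"
  shows "(\<Sum>p\<in>A. ln (real p)) \<le> ln (real n)"
proof -
  have "(\<Sum>p\<in>A. ln (real p)) \<le> (\<Sum>p\<in>A. real (multiplicity p n) * ln (real p))"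
  proof (rule sum_mono)
    fix p assume "p \<in> A"
    with assms have p: "prime p" "p dvd n" by auto
    then have "multiplicity p n \<ge> 1"
      using assms by (simp add: Suc_le_eq prime_multiplicity_gt_zero_iff)
    moreover have "ln (real p) \<ge> 0" using prime_ge_1_nat[OF p(1)] by simp
    ultimately show "ln (real p) \<le> real (multiplicity p n) * ln (real p)"
      using mult_right_mono[of 1 "real (multiplicity p n)" "ln (real p)"] by simp
  qed
  also have "\<dots> \<le> (\<Sum>p\<in>primes_between 0 (real n). real (multiplicity p n) * ln (real p))"
  proof (rule sum_mono2)
    show "A \<subseteq> primes_between 0 (real n)"
      using assms by (auto simp: primes_between_def prime_gt_0_nat dest!: assms(3) dvd_imp_le)
  qed (auto dest: primes_between_gt_1)
  also have "\<dots> = ln (real n)"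
    using assms by (intro ln_eq_sum_multiplicity[symmetric]) (auto dest!: dvd_imp_le)
  finally show ?thesis .
qed

text \<open>Pairs \<open>(q, n)\<close> with \<open>q\<close> dividing \<open>n\<close> are counted
  with weight \<open>ln q\<close>: a fixed \<open>q\<close> has
  \<open>smooth_count (x / q) y\<close> multiples, and for a fixed \<open>n\<close> the weights sum
  to at most \<open>ln n <= ln x\<close>.\<close>

lemma sum_ln_smooth_count_le:
  assumes "x \<ge> 1" "y \<ge> 1"
  shows "(\<Sum>q\<in>primes_between 0 y. ln (real q) * real (smooth_count (x / real q) y)) \<le> ln x * real (smooth_count x y)"
proof -
  have "(\<Sum>q\<in>primes_between 0 y. ln (real q) * real (smooth_count (x / real q) y)) =
        (\<Sum>q\<in>primes_between 0 y. \<Sum>n | n \<in> smooth_set x y \<and> q dvd n. ln (real q))"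
  proof (rule sum.cong)
    fix q assume "q \<in> primes_between 0 y"
    then have "card {n \<in> smooth_set x y. q dvd n} = smooth_count (x / real q) y"
      using assms by (intro card_smooth_multiples[of y q "real q"] prime_in_smooth_set) (auto simp: primes_between_def)
    then show "ln (real q) * real (smooth_count (x / real q) y) = (\<Sum>n | n \<in> smooth_set x y \<and> q dvd n. ln (real q))"
      by simp
  qed simp
  also have "\<dots> = (\<Sum>n\<in>smooth_set x y. \<Sum>q | q \<in> primes_between 0 y \<and> q dvd n. ln (real q))"
    by (rule sum.swap_restrict) auto
  also have "\<dots> \<le> (\<Sum>n\<in>smooth_set x y. ln x)"
  proof (rule sum_mono)
    fix n assume "n \<in> smooth_set x y"
    then have n: "n \<ge> 1" "real n \<le> x" using smooth_set_pos by auto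
    have "(\<Sum>q | q \<in> primes_between 0 y \<and> q dvd n. ln (real q)) \<le> ln (real n)"
      using n by (intro sum_ln_prime_divisors_le) (auto simp: primes_between_def)
    also have "\<dots> \<le> ln x" using n by (intro ln_mono) auto
    finally show "(\<Sum>q | q \<in> primes_between 0 y \<and> q dvd n. ln (real q)) \<le> ln x" .
  qed
  also have "\<dots> = ln x * real (smooth_count x y)"
    by (simp add: smooth_count_def)
  finally show ?thesis .
qed

text \<open>A number up to \<open>x\<close> has at most \<open>ln x / ln T\<close> distinct prime
  divisors above \<open>T\<close>. For \<open>ln T\<close> comparable to \<open>ln y\<close> this is
  of order \<open>u\<close>, so no logarithm of \<open>y\<close> is lost.\<close>

lemma sum_smooth_count_large_primes_le:
  assumes "x \<ge> 1" "y \<ge> 1" "T > 1"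
  shows "(\<Sum>q\<in>primes_between T y. real (smooth_count (x / real q) y)) \<le> ln x / ln T * real (smooth_count x y)"
proof -
  have "ln T * (\<Sum>q\<in>primes_between T y. real (smooth_count (x / real q) y)) =
        (\<Sum>q\<in>primes_between T y. ln T * real (smooth_count (x / real q) y))"
    by (simp add: sum_distrib_left)
  also have "\<dots> \<le> (\<Sum>q\<in>primes_between T y. ln (real q) * real (smooth_count (x / real q) y))"
    using assms by (intro sum_mono mult_right_mono ln_mono) (auto simp: primes_between_def)
  also have "\<dots> \<le> (\<Sum>q\<in>primes_between 0 y. ln (real q) * real (smooth_count (x / real q) y))"
  proof (rule sum_mono2)
    show "primes_between T y \<subseteq> primes_between 0 y"
      using assms by (auto simp: primes_between_def)
  qed (auto dest: primes_between_gt_1)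
  also have "\<dots> \<le> ln x * real (smooth_count x y)"
    using assms by (intro sum_ln_smooth_count_le) auto
  finally show ?thesis using assms by (simp add: field_simps)
qed

text \<open>The weight has two merits over counting \<open>m <= x / A\<close>: the identity
  \<open>min (A * q) X = q * min A (X / q)\<close> allows a prime to be absorbed, and
  \<open>min A (x / m)\<close> is comparable to a count of integers, or to a Chebyshev sum over
  primes, up to that bound.\<close>

definition truncated_sum :: "real \<Rightarrow> real \<Rightarrow> real \<Rightarrow> real" where
  "truncated_sum A x y = (\<Sum>m\<in>smooth_set x y. min A (x / real m))"

text \<open>Since \<open>q >= 1\<close>, the conditions \<open>m <= x\<close> and
  \<open>q * m <= x\<close> together amount to \<open>m <= x / q\<close>. Thus an inner sum over
  primes up to \<open>x / m\<close> becomes a sum of smooth sums at \<open>x / q\<close>.\<close>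

lemma sum_primes_smooth_swap:
  assumes "x \<ge> 0" "finite Q" "\<And>q. q \<in> Q \<Longrightarrow> real q \<ge> 1"
  shows "(\<Sum>m\<in>smooth_set x y. \<Sum>q | q \<in> Q \<and> real q \<le> x / real m. f q m) =
         (\<Sum>q\<in>Q. \<Sum>m\<in>smooth_set (x / real q) y. (f q m :: real))"
proof -
  have "(\<Sum>m\<in>smooth_set x y. \<Sum>q | q \<in> Q \<and> real q \<le> x / real m. f q m) =
        (\<Sum>q\<in>Q. \<Sum>m | m \<in> smooth_set x y \<and> real q \<le> x / real m. f q m)"
    using assms by (intro sum.swap_restrict) auto
  also have "\<dots> = (\<Sum>q\<in>Q. \<Sum>m\<in>smooth_set (x / real q) y. f q m)"
  proof (rule sum.cong[OF refl], rule sum.cong)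
    fix q assume q: "q \<in> Q"
    have "real m \<le> x" if "real m \<le> x / real q" for m
      using that assms(1) assms(3)[OF q] by (smt (verit) divide_le_eq_1 frac_le of_nat_0_le_iff div_by_1)
    then show "{m. m \<in> smooth_set x y \<and> real q \<le> x / real m} = smooth_set (x / real q) y"
      using assms(3)[OF q] by (auto simp: smooth_set_def field_simps)
  qed simp
  finally show ?thesis .
qed

text \<open>Chebyshev's lower bound turns \<open>min y (x / m)\<close> into a sum of
  \<open>ln q\<close> over primes \<open>q <= y\<close> with \<open>q * m <= x\<close>, to which the
  double counting applies. The 2 covers the values below 2, where no prime is available.\<close>

lemma truncated_sum_base:
  "\<exists>C>0. \<forall>x\<ge>1. \<forall>y\<ge>2. truncated_sum y x y \<le> (2 + C * ln x) * real (smooth_count x y)"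
proof -
  obtain c where c: "c > 0" "\<And>t. t \<ge> 2 \<Longrightarrow> c * t \<le> (\<Sum>p\<in>primes_between 0 t. ln (real p))"
    using theta_ge by blast
  show ?thesis
  proof (intro exI[of _ "1 / c"] conjI allI impI)
    fix x y :: real assume xy: "x \<ge> 1" "y \<ge> 2"
    have "truncated_sum y x y \<le> (\<Sum>m\<in>smooth_set x y. 2 + (1 / c) * (\<Sum>q | q \<in> primes_between 0 y \<and> real q \<le> x / real m. ln (real q)))"
      unfolding truncated_sum_def
    proof (rule sum_mono)
      fix m
      have eq: "{q. q \<in> primes_between 0 y \<and> real q \<le> x / real m} = primes_between 0 (min y (x / real m))"
        by (auto simp: primes_between_def)
      show "min y (x / real m) \<le> 2 + (1 / c) * (\<Sum>q | q \<in> primes_between 0 y \<and> real q \<le> x / real m. ln (real q))"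
      proof (cases "min y (x / real m) \<ge> 2")
        case True
        have "min y (x / real m) \<le> (1 / c) * (\<Sum>q\<in>primes_between 0 (min y (x / real m)). ln (real q))"
          using c(2)[OF True] c(1) by (simp add: field_simps)
        then show ?thesis unfolding eq by linarith
      next
        case False
        have "0 \<le> (1 / c) * (\<Sum>q\<in>primes_between 0 (min y (x / real m)). ln (real q))"
          using c(1) by (intro mult_nonneg_nonneg sum_nonneg) (auto dest: primes_between_gt_1)
        then show ?thesis unfolding eq using False by linarith
      qed
    qed
    also have "\<dots> = 2 * real (smooth_count x y) + (1 / c) * (\<Sum>m\<in>smooth_set x y. \<Sum>q | q \<in> primes_between 0 y \<and> real q \<le> x / real m. ln (real q))"
      by (simp add: sum.distrib sum_distrib_left smooth_count_def)
    also have "(\<Sum>m\<in>smooth_set x y. \<Sum>q | q \<in> primes_between 0 y \<and> real q \<le> x / real m. ln (real q)) =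
        (\<Sum>q\<in>primes_between 0 y. \<Sum>m\<in>smooth_set (x / real q) y. ln (real q))"
      using xy by (intro sum_primes_smooth_swap) (auto dest: primes_between_gt_1)
    also have "\<dots> = (\<Sum>q\<in>primes_between 0 y. ln (real q) * real (smooth_count (x / real q) y))"
      by (simp add: smooth_count_def mult.commute)
    also have "\<dots> \<le> ln x * real (smooth_count x y)"
      using xy by (intro sum_ln_smooth_count_le) auto
    finally show "truncated_sum y x y \<le> (2 + 1 / c * ln x) * real (smooth_count x y)"
      using c(1) by (simp add: algebra_simps divide_right_mono)
  qed (use c in auto)
qed

text \<open>For \<open>x / m > y\<close> every prime \<open>q \<le> y\<close> can be absorbed into \<open>m\<close>. As the primes in \<open>(T, y]\<close> carry the
  positive reciprocal mass \<open>c\<close>, raising \<open>A\<close> by the factor \<open>T\<close> costs no logarithm.\<close>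

lemma truncated_sum_step:
  assumes "x \<ge> 1" "1 < T" "T \<le> y" "A \<ge> 0" "c > 0"
    and c: "c \<le> (\<Sum>q\<in>primes_between T y. 1 / real q)"
  shows "c * truncated_sum (A * T) x y \<le> c * truncated_sum y x y + (\<Sum>q\<in>primes_between T y. truncated_sum A (x / real q) y)"
proof -
  let ?Q = "primes_between T y"
  have "c * truncated_sum (A * T) x y \<le>
    (\<Sum>m\<in>smooth_set x y. c * min y (x / real m) + (\<Sum>q | q \<in> ?Q \<and> real q \<le> x / real m. min A (x / real q / real m)))"
    unfolding truncated_sum_def sum_distrib_left
  proof (rule sum_mono)
    fix m assume "m \<in> smooth_set x y"
    then have m: "m \<ge> 1" "real m \<le> x" using smooth_set_pos by auto
    let ?X = "x / real m"
    have X: "?X \<ge> 1" using m by simp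
    show "c * min (A * T) ?X \<le> c * min y ?X + (\<Sum>q | q \<in> ?Q \<and> real q \<le> ?X. min A (x / real q / real m))"
    proof (cases "?X \<le> y")
      case True
      have "c * min (A * T) ?X \<le> c * min y ?X" using True assms by (intro mult_left_mono) auto
      moreover have "(\<Sum>q | q \<in> ?Q \<and> real q \<le> ?X. min A (x / real q / real m)) \<ge> 0"
        using assms by (intro sum_nonneg) auto
      ultimately show ?thesis by linarith
    next
      case False
      have eq: "{q. q \<in> ?Q \<and> real q \<le> ?X} = ?Q" using False by (auto simp: primes_between_def)
      have "c * min (A * T) ?X \<le> (\<Sum>q\<in>?Q. 1 / real q) * min (A * T) ?X"
        using c assms X by (intro mult_right_mono) auto
      also have "\<dots> = (\<Sum>q\<in>?Q. 1 / real q * min (A * T) ?X)" by (rule sum_distrib_right)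
      also have "\<dots> \<le> (\<Sum>q\<in>?Q. min A (x / real q / real m))"
      proof (rule sum_mono)
        fix q assume q: "q \<in> ?Q"
        then have q': "real q > 0" "T \<le> real q" using assms by (auto simp: primes_between_def)
        have "min (A * T) ?X \<le> min (A * real q) ?X"
          using assms q' by (intro min.mono mult_left_mono) auto
        also have "\<dots> = real q * min A (x / real q / real m)"
          using q' by (simp add: min_mult_distrib_left mult.commute)
        finally have "1 / real q * min (A * T) ?X \<le> 1 / real q * (real q * min A (x / real q / real m))"
          by (intro mult_left_mono) auto
        also have "\<dots> = min A (x / real q / real m)"
          using q' by simp
        finally show "1 / real q * min (A * T) ?X \<le> min A (x / real q / real m)" .
      qed
      also have "\<dots> \<le> c * min y ?X + (\<Sum>q\<in>?Q. min A (x / real q / real m))"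
        using assms X by simp
      finally show ?thesis unfolding eq .
    qed
  qed
  also have "\<dots> = c * truncated_sum y x y + (\<Sum>m\<in>smooth_set x y. \<Sum>q | q \<in> ?Q \<and> real q \<le> x / real m. min A (x / real q / real m))"
    by (simp add: sum.distrib truncated_sum_def sum_distrib_left)
  also have "(\<Sum>m\<in>smooth_set x y. \<Sum>q | q \<in> ?Q \<and> real q \<le> x / real m. min A (x / real q / real m)) =
      (\<Sum>q\<in>?Q. truncated_sum A (x / real q) y)"
    unfolding truncated_sum_def using assms by (intro sum_primes_smooth_swap finite_primes_between) (auto simp: primes_between_def)
  finally show ?thesis .
qed

text \<open>Each step multiplies the truncation by \<open>T\<close> at the cost of one factor
  \<open>1 + ln X / (c * ln T)\<close>. The step passes from \<open>x\<close> to the quotients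
  \<open>x / q\<close>, so the starting bound \<open>K\<close> is assumed for all arguments up to a
  common \<open>X\<close>.\<close>

lemma truncated_sum_iterate:
  assumes "1 < T" "T \<le> y" "c > 0" "K \<ge> 0" "X \<ge> 1"
    and c: "c \<le> (\<Sum>q\<in>primes_between T y. 1 / real q)"
    and K: "\<And>x. 1 \<le> x \<Longrightarrow> x \<le> X \<Longrightarrow> truncated_sum y x y \<le> K * real (smooth_count x y)"
    and "x \<le> X"
  shows "truncated_sum (y * T ^ s) x y \<le> K * (1 + ln X / (c * ln T)) ^ s * real (smooth_count x y)"
  using \<open>x \<le> X\<close>
proof (induction s arbitrary: x)
  case 0
  show ?case
    using K[of x] 0 by (cases "x \<ge> 1") (auto simp: truncated_sum_def smooth_count_def smooth_set_empty)
next
  case (Suc s)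
  let ?R = "1 + ln X / (c * ln T)"
  have R: "?R \<ge> 1" using assms by auto
  show ?case
  proof (cases "x \<ge> 1")
    case True
    have "c * truncated_sum (y * T ^ s * T) x y \<le>
        c * truncated_sum y x y + (\<Sum>q\<in>primes_between T y. truncated_sum (y * T ^ s) (x / real q) y)"
      using assms True by (intro truncated_sum_step) auto
    also have "(\<Sum>q\<in>primes_between T y. truncated_sum (y * T ^ s) (x / real q) y) \<le>
        (\<Sum>q\<in>primes_between T y. K * ?R ^ s * real (smooth_count (x / real q) y))"
    proof (intro sum_mono Suc.IH)
      fix q assume "q \<in> primes_between T y"
      then have "x / real q \<le> x / 1" using True by (intro divide_left_mono) (auto dest!: primes_between_gt_1)
      then show "x / real q \<le> X" using Suc by simp
    qed
    also have "\<dots> = K * ?R ^ s * (\<Sum>q\<in>primes_between T y. real (smooth_count (x / real q) y))"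
      by (simp add: sum_distrib_left)
    also have "\<dots> \<le> K * ?R ^ s * (ln x / ln T * real (smooth_count x y))"
      using assms True R by (intro mult_left_mono sum_smooth_count_large_primes_le) auto
    also have "\<dots> \<le> K * ?R ^ s * (ln X / ln T * real (smooth_count x y))"
      using assms True R Suc.prems by (intro mult_left_mono mult_right_mono divide_right_mono ln_mono) auto
    also have "c * truncated_sum y x y \<le> c * (K * ?R ^ s * real (smooth_count x y))"
    proof (intro mult_left_mono)
      have "truncated_sum y x y \<le> K * 1 * real (smooth_count x y)" using K[OF True Suc.prems] by simp
      also have "\<dots> \<le> K * ?R ^ s * real (smooth_count x y)"
        using R assms by (intro mult_left_mono mult_right_mono one_le_power) auto
      finally show "truncated_sum y x y \<le> K * ?R ^ s * real (smooth_count x y)" .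
    qed (use assms in auto)
    finally have "c * truncated_sum (y * T ^ s * T) x y \<le>
        K * ?R ^ s * real (smooth_count x y) * (c + ln X / ln T)"
      by (simp add: algebra_simps)
    also have "c + ln X / ln T = c * ?R"
      using assms by (simp add: field_simps)
    finally have "c * truncated_sum (y * T ^ s * T) x y \<le> c * (K * ?R ^ Suc s * real (smooth_count x y))"
      by (simp add: mult_ac)
    then show ?thesis using assms by (simp add: mult_ac)
  qed (simp add: truncated_sum_def smooth_count_def smooth_set_empty)
qed

lemma smooth_count_div_le_truncated_sum:
  assumes "P \<ge> 1"
  shows "P * real (smooth_count (x / P) y) \<le> truncated_sum P x y"
proof -
  have "P * real (smooth_count (x / P) y) = (\<Sum>m\<in>smooth_set (x / P) y. P)"
    by (simp add: smooth_count_def)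
  also have "\<dots> \<le> (\<Sum>m\<in>smooth_set (x / P) y. min P (x / real m))"
    using assms by (intro sum_mono) (auto simp: smooth_set_def field_simps)
  also have "\<dots> \<le> truncated_sum P x y"
    unfolding truncated_sum_def
  proof (rule sum_mono2)
    show "smooth_set (x / P) y \<subseteq> smooth_set x y"
    proof (cases "x \<ge> 0")
      case True
      then have "x / P \<le> x / 1" using assms by (intro divide_left_mono) auto
      then show ?thesis by (intro smooth_set_mono) auto
    next
      case False
      then have "x / P < 1" using assms by (simp add: field_simps)
      then show ?thesis by (simp add: smooth_set_empty)
    qed
  qed (use assms in \<open>auto dest!: smooth_set_pos\<close>)
  finally show ?thesis .
qed

lemma truncated_sum_mono: "A \<le> B \<Longrightarrow> truncated_sum A x y \<le> truncated_sum B x y"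
  unfolding truncated_sum_def by (intro sum_mono) auto

section \<open>Sums weighted by the number of prime factors\<close>

definition prime_Omega :: "nat \<Rightarrow> nat" where
  "prime_Omega n = size (prime_factorization n)"

lemma prime_Omega_mult: "a > 0 \<Longrightarrow> b > 0 \<Longrightarrow> prime_Omega (a * b) = prime_Omega a + prime_Omega b"
  by (simp add: prime_Omega_def prime_factorization_mult)

lemma prime_Omega_prime: "prime p \<Longrightarrow> prime_Omega p = 1"
  by (simp add: prime_Omega_def prime_factorization_prime)

text \<open>A divisor of \<open>p * m\<close> either divides \<open>m\<close> or is \<open>p\<close>
  times a divisor of \<open>m\<close>, so each prime factor at most doubles the count.\<close>

lemma card_divisors_le:
  assumes "n > 0"
  shows "card {d. d dvd n} \<le> 2 ^ prime_Omega n"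
  using assms
proof (induction n rule: less_induct)
  case (less n)
  show ?case
  proof (cases "n = 1")
    case False
    then obtain p where p: "prime p" "p dvd n" using prime_factor_nat by blast
    then obtain m where m: "n = p * m" by auto
    have "m > 0" "m < n" using m less.prems prime_gt_1_nat[OF p(1)] by auto
    have "{d. d dvd n} \<subseteq> {d. d dvd m} \<union> (\<lambda>e. p * e) ` {d. d dvd m}"
    proof
      fix d assume d: "d \<in> {d. d dvd n}"
      show "d \<in> {d. d dvd m} \<union> (\<lambda>e. p * e) ` {d. d dvd m}"
      proof (cases "p dvd d")
        case True
        then obtain e where "d = p * e" by auto
        then show ?thesis using d m p by auto
      next
        case False
        then have "coprime d p" using p prime_imp_coprime coprime_commute by blast
        then show ?thesis using d m by (auto simp: coprime_dvd_mult_right_iff)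
      qed
    qed
    then have "card {d. d dvd n} \<le> card ({d. d dvd m} \<union> (\<lambda>e. p * e) ` {d. d dvd m})"
      using \<open>m > 0\<close> by (intro card_mono) auto
    also have "\<dots> \<le> card {d. d dvd m} + card ((\<lambda>e. p * e) ` {d. d dvd m})"
      by (rule card_Un_le)
    also have "\<dots> \<le> card {d. d dvd m} + card {d. d dvd m}"
      using \<open>m > 0\<close> by (intro add_left_mono card_image_le) auto
    also have "\<dots> \<le> 2 ^ prime_Omega m + 2 ^ prime_Omega m"
      using less.IH[OF \<open>m < n\<close> \<open>m > 0\<close>] by simp
    also have "\<dots> = 2 ^ prime_Omega n"
      using m p \<open>m > 0\<close> by (simp add: prime_Omega_mult prime_Omega_prime prime_gt_0_nat)
    finally show ?thesis .
  qed (simp add: prime_Omega_def)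
qed

section \<open>Smooth sums weighted by \<open>(1 / 2) ^ prime_Omega a\<close>\<close>

definition half_sum :: "real \<Rightarrow> real \<Rightarrow> real" where
  "half_sum x y = (\<Sum>a\<in>smooth_set x y. (1 / 2) ^ prime_Omega a)"

lemma half_sum_nonneg: "half_sum x y \<ge> 0"
  by (simp add: half_sum_def sum_nonneg)

text \<open>Writing \<open>a = p b\<close> bounds the left-hand side by half of \<open>half_sum (x / p) y\<close> plus half of itself,
  so prime powers need no separate treatment.\<close>

lemma half_sum_multiplicity_le:
  assumes "prime p" "real p \<le> y"
  shows "(\<Sum>a\<in>smooth_set x y. (1 / 2) ^ prime_Omega a * real (multiplicity p a)) \<le> half_sum (x / real p) y"
proof (cases "x \<ge> 0")
  case True
  have p: "p > 0" "y \<ge> 1" using assms prime_gt_0_nat[of p] prime_ge_1_nat[of p] by auto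
  define V where "V x = (\<Sum>a\<in>smooth_set x y. (1 / 2) ^ prime_Omega a * real (multiplicity p a))" for x
  have "V x = (\<Sum>a | a \<in> smooth_set x y \<and> p dvd a. (1 / 2) ^ prime_Omega a * real (multiplicity p a))"
    unfolding V_def by (rule sum.mono_neutral_right) (auto simp: not_dvd_imp_multiplicity_0)
  also have "\<dots> = (\<Sum>b\<in>smooth_set (x / real p) y. (1 / 2) ^ prime_Omega (p * b) * real (multiplicity p (p * b)))"
    using sum.reindex_bij_betw[OF bij_betw_smooth_multiples[OF p(2) prime_in_smooth_set[OF assms]],
        of "\<lambda>a. (1 / 2) ^ prime_Omega a * real (multiplicity p a)"] by simp
  also have "\<dots> = (\<Sum>b\<in>smooth_set (x / real p) y. (1 / 2) * (1 / 2) ^ prime_Omega b + (1 / 2) * ((1 / 2) ^ prime_Omega b * real (multiplicity p b)))"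
  proof (rule sum.cong)
    fix b assume "b \<in> smooth_set (x / real p) y"
    then have b: "b > 0" using smooth_set_pos by fastforce
    then have "multiplicity p (p * b) = Suc (multiplicity p b)"
      using p prime_gt_1_nat[OF assms(1)] by (intro multiplicity_times_same) auto
    moreover have "prime_Omega (p * b) = Suc (prime_Omega b)"
      using p b assms by (simp add: prime_Omega_mult prime_Omega_prime)
    ultimately show "(1 / 2) ^ prime_Omega (p * b) * real (multiplicity p (p * b)) =
        (1 / 2) * (1 / 2) ^ prime_Omega b + (1 / 2) * ((1 / 2) ^ prime_Omega b * real (multiplicity p b))"
      by (simp add: algebra_simps)
  qed simp
  also have "\<dots> = half_sum (x / real p) y / 2 + V (x / real p) / 2"
    by (simp add: sum.distrib half_sum_def V_def sum_divide_distrib)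
  also have "V (x / real p) \<le> V x"
  proof -
    have "x / real p \<le> x / 1" using p True by (intro divide_left_mono) auto
    then show ?thesis unfolding V_def by (intro sum_mono2 smooth_set_mono) auto
  qed
  finally show ?thesis by (simp add: V_def)
qed (simp add: smooth_set_empty half_sum_nonneg)

text \<open>Split \<open>ln X = ln a + ln (X / a)\<close>. In the first part one writes
  \<open>ln a\<close> as a sum over primes, removes a prime \<open>p\<close> from \<open>a\<close>,
  and sums \<open>ln p\<close> over \<open>p <= min y (X / a)\<close> by Chebyshev, with constant 6.
  The second part is at most \<open>min y (X / a)\<close> because \<open>ln X <= y\<close>, which
  makes the constant 7.\<close>

lemma half_sum_ln_le:
  assumes "X \<ge> 1" "y \<ge> 2" "ln X \<le> y"
  shows "half_sum X y * ln X \<le> 7 * (\<Sum>a\<in>smooth_set X y. (1 / 2) ^ prime_Omega a * min y (X / real a))"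
proof -
  let ?f = "\<lambda>a. (1 / 2 :: real) ^ prime_Omega a"
  have "half_sum X y * ln X = (\<Sum>a\<in>smooth_set X y. ?f a * ln X)"
    by (simp add: half_sum_def sum_distrib_right)
  also have "\<dots> = (\<Sum>a\<in>smooth_set X y. ?f a * ln (real a) + ?f a * ln (X / real a))"
    using assms by (intro sum.cong refl) (auto simp: ln_div algebra_simps dest!: smooth_set_pos)
  also have "\<dots> = (\<Sum>a\<in>smooth_set X y. ?f a * ln (real a)) + (\<Sum>a\<in>smooth_set X y. ?f a * ln (X / real a))"
    by (simp add: sum.distrib)
  also have "(\<Sum>a\<in>smooth_set X y. ?f a * ln (X / real a)) \<le> (\<Sum>a\<in>smooth_set X y. ?f a * min y (X / real a))"
  proof (intro sum_mono mult_left_mono)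
    fix a assume "a \<in> smooth_set X y"
    then have a: "a \<ge> 1" "real a \<le> X" using smooth_set_pos by auto
    have "ln (X / real a) \<le> ln X" using a assms by (intro ln_mono) (auto simp: field_simps)
    moreover have "ln (X / real a) \<le> X / real a - 1" using a by (intro ln_le_minus_one) auto
    ultimately show "ln (X / real a) \<le> min y (X / real a)" using assms by auto
  qed auto
  also have "(\<Sum>a\<in>smooth_set X y. ?f a * ln (real a)) =
      (\<Sum>a\<in>smooth_set X y. \<Sum>p\<in>primes_between 0 y. ln (real p) * (?f a * real (multiplicity p a)))"
  proof (rule sum.cong)
    fix a assume "a \<in> smooth_set X y"
    then have "ln (real a) = (\<Sum>p\<in>primes_between 0 y. real (multiplicity p a) * ln (real p))"
      using assms by (intro ln_eq_sum_multiplicity) (auto simp: smooth_set_iff)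
    then show "?f a * ln (real a) = (\<Sum>p\<in>primes_between 0 y. ln (real p) * (?f a * real (multiplicity p a)))"
      by (simp add: sum_distrib_left mult_ac)
  qed simp
  also have "\<dots> = (\<Sum>p\<in>primes_between 0 y. ln (real p) * (\<Sum>a\<in>smooth_set X y. ?f a * real (multiplicity p a)))"
    by (subst sum.swap) (simp add: sum_distrib_left)
  also have "\<dots> \<le> (\<Sum>p\<in>primes_between 0 y. ln (real p) * half_sum (X / real p) y)"
    by (intro sum_mono mult_left_mono half_sum_multiplicity_le)
       (auto simp: primes_between_def Suc_le_eq prime_gt_0_nat)
  also have "\<dots> = (\<Sum>p\<in>primes_between 0 y. \<Sum>a\<in>smooth_set (X / real p) y. ln (real p) * ?f a)"
    by (simp add: half_sum_def sum_distrib_left)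
  also have "\<dots> = (\<Sum>a\<in>smooth_set X y. \<Sum>p | p \<in> primes_between 0 y \<and> real p \<le> X / real a. ln (real p) * ?f a)"
    using assms by (intro sum_primes_smooth_swap[symmetric]) (auto dest: primes_between_gt_1)
  also have "\<dots> \<le> (\<Sum>a\<in>smooth_set X y. 6 * (?f a * min y (X / real a)))"
  proof (rule sum_mono)
    fix a assume "a \<in> smooth_set X y"
    have eq: "{p. p \<in> primes_between 0 y \<and> real p \<le> X / real a} = primes_between 0 (min y (X / real a))"
      by (auto simp: primes_between_def)
    have "(\<Sum>p | p \<in> primes_between 0 y \<and> real p \<le> X / real a. ln (real p) * ?f a) =
        (\<Sum>p\<in>primes_between 0 (min y (X / real a)). ln (real p)) * ?f a"
      unfolding eq by (simp add: sum_distrib_right)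
    also have "\<dots> \<le> 6 * min y (X / real a) * ?f a"
      using assms by (intro mult_right_mono theta_le) auto
    finally show "(\<Sum>p | p \<in> primes_between 0 y \<and> real p \<le> X / real a. ln (real p) * ?f a) \<le> 6 * (?f a * min y (X / real a))"
      by (simp add: mult_ac)
  qed
  finally show ?thesis by (simp flip: sum_distrib_left)
qed

text \<open>The terms of the square are grouped by \<open>n = a * b\<close>. The weights multiply to
  \<open>(1 / 2) ^ prime_Omega n\<close>, which cancels the number of representations of
  \<open>n\<close>, and the product of the two minima is at most
  \<open>min (y ^ 2) (X ^ 2 / n)\<close>.\<close>

lemma half_sum_square_le:
  assumes "X \<ge> 1" "y \<ge> 2" "ln X \<le> y"
  shows "(half_sum X y * ln X)\<^sup>2 \<le> 49 * truncated_sum (y\<^sup>2) (X\<^sup>2) y"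
proof -
  let ?f = "\<lambda>a. (1 / 2 :: real) ^ prime_Omega a"
  let ?S = "smooth_set X y"
  define h where "h n = ?f n * min (y\<^sup>2) (X\<^sup>2 / real n)" for n
  have h0: "h n \<ge> 0" for n by (simp add: h_def)
  have "(half_sum X y * ln X)\<^sup>2 \<le> (7 * (\<Sum>a\<in>?S. ?f a * min y (X / real a)))\<^sup>2"
    using assms by (intro power_mono half_sum_ln_le mult_nonneg_nonneg half_sum_nonneg) auto
  also have "\<dots> = 49 * (\<Sum>(a, b)\<in>?S \<times> ?S. (?f a * min y (X / real a)) * (?f b * min y (X / real b)))"
    by (simp add: power2_eq_square sum_product sum.cartesian_product)
  also have "(\<Sum>(a, b)\<in>?S \<times> ?S. (?f a * min y (X / real a)) * (?f b * min y (X / real b))) \<le>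
      (\<Sum>(a, b)\<in>?S \<times> ?S. h (a * b))"
  proof (rule sum_mono, clarify)
    fix a b assume ab: "a \<in> ?S" "b \<in> ?S"
    then have pos: "a > 0" "b > 0" using smooth_set_pos by fastforce+
    have "min y (X / real a) * min y (X / real b) \<le> y * y"
      using assms by (intro mult_mono) auto
    moreover have "min y (X / real a) * min y (X / real b) \<le> X / real a * (X / real b)"
      using assms by (intro mult_mono) auto
    ultimately have "min y (X / real a) * min y (X / real b) \<le> min (y\<^sup>2) (X\<^sup>2 / real (a * b))"
      by (simp add: power2_eq_square)
    then have "?f (a * b) * (min y (X / real a) * min y (X / real b)) \<le> h (a * b)"
      unfolding h_def by (intro mult_left_mono) auto
    then show "(?f a * min y (X / real a)) * (?f b * min y (X / real b)) \<le> h (a * b)"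
      using pos by (simp add: prime_Omega_mult power_add mult_ac)
  qed
  also have "(\<Sum>(a, b)\<in>?S \<times> ?S. h (a * b)) = (\<Sum>p\<in>?S \<times> ?S. h (fst p * snd p))"
    by (simp add: case_prod_unfold)
  also have "\<dots> = (\<Sum>n\<in>smooth_set (X\<^sup>2) y. \<Sum>p | p \<in> ?S \<times> ?S \<and> fst p * snd p = n. h (fst p * snd p))"
  proof (rule sum.group[symmetric])
    show "(\<lambda>p. fst p * snd p) ` (?S \<times> ?S) \<subseteq> smooth_set (X\<^sup>2) y"
      using assms smooth_set_mult[of y _ X _ X "X\<^sup>2"] by (auto simp: power2_eq_square)
  qed auto
  also have "\<dots> \<le> (\<Sum>n\<in>smooth_set (X\<^sup>2) y. min (y\<^sup>2) (X\<^sup>2 / real n))"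
  proof (rule sum_mono)
    fix n assume "n \<in> smooth_set (X\<^sup>2) y"
    then have n: "n > 0" using smooth_set_pos by fastforce
    let ?D = "{p. p \<in> ?S \<times> ?S \<and> fst p * snd p = n}"
    have "card ?D \<le> card {d. d dvd n}"
    proof (rule card_inj_on_le)
      show "inj_on fst ?D" using n by (auto simp: inj_on_def)
      show "fst ` ?D \<subseteq> {d. d dvd n}" by auto
    qed (use n in auto)
    also have "\<dots> \<le> 2 ^ prime_Omega n" by (rule card_divisors_le[OF n])
    finally have "real (card ?D) \<le> real (2 ^ prime_Omega n)"
      by (rule of_nat_mono)
    then have "real (card ?D) \<le> 2 ^ prime_Omega n"
      by simp
    then have "real (card ?D) * h n \<le> 2 ^ prime_Omega n * h n"
      by (intro mult_right_mono h0)
    also have "\<dots> = min (y\<^sup>2) (X\<^sup>2 / real n)"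
      by (simp add: h_def power_divide)
    finally show "(\<Sum>p | p \<in> ?S \<times> ?S \<and> fst p * snd p = n. h (fst p * snd p)) \<le> min (y\<^sup>2) (X\<^sup>2 / real n)"
      by simp
  qed
  finally show ?thesis by (simp add: truncated_sum_def)
qed

text \<open>The primes are added one at a time. The factor for \<open>p\<close> is
  \<open>(1 - 1 / p) / (1 - w / p)\<close>, the Euler factor of the mean value of
  \<open>w ^ prime_Omega d\<close>; \<open>w < 2\<close> keeps it finite and positive at
  \<open>p = 2\<close>.\<close>

lemma sum_power_multiplicity_le:
  fixes w :: real
  assumes "finite P" "\<And>p. p \<in> P \<Longrightarrow> prime p" "1 \<le> w" "w < 2"
  shows "(\<Sum>d=1..n. w ^ (\<Sum>p\<in>P. multiplicity p d)) \<le> real n * (\<Prod>p\<in>P. 1 + (w - 1) / (real p - w))"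
  using assms(1,2)
proof (induction P arbitrary: n rule: finite_induct)
  case (insert p P)
  have p: "prime p" using insert by simp
  then have p2: "real p \<ge> 2" using prime_ge_2_nat by force
  define W where "W d = w ^ (\<Sum>p\<in>P. multiplicity p d)" for d
  define c where "c = (\<Prod>p\<in>P. 1 + (w - 1) / (real p - w))"
  define D where "D n = (\<Sum>d=1..n. (w ^ multiplicity p d - 1) * W d)" for n
  have G: "(\<Sum>d=1..n. W d) \<le> real n * c" for n
    using insert by (simp add: W_def c_def)
  have c0: "c \<ge> 0" unfolding c_def
  proof (intro prod_nonneg ballI)
    fix q assume "q \<in> P"
    then have "q \<ge> 2" using insert by (intro prime_ge_2_nat) auto
    then have "real q \<ge> 2" by simp
    then show "0 \<le> 1 + (w - 1) / (real q - w)" using assms by (intro add_nonneg_nonneg divide_nonneg_nonneg) auto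
  qed
  have Wp: "W (p * e) = W e" if "e > 0" for e
  proof -
    have "multiplicity q (p * e) = multiplicity q e" if "q \<in> P" for q
    proof -
      have "prime q" "q \<noteq> p" using that insert by auto
      then show ?thesis using p \<open>e > 0\<close>
        by (subst prime_elem_multiplicity_mult_distrib) (auto simp: prime_multiplicity_other)
    qed
    then show ?thesis by (simp add: W_def)
  qed
  have D_rec: "D n = (w - 1) * (\<Sum>e=1..n div p. W e) + w * D (n div p)" for n
  proof -
    have "D n = (\<Sum>d\<in>(\<lambda>e. p * e) ` {1..n div p}. (w ^ multiplicity p d - 1) * W d)"
      unfolding D_def
    proof (rule sum.mono_neutral_right)
      show "(\<lambda>e. p * e) ` {1..n div p} \<subseteq> {1..n}"
        using prime_gt_0_nat[OF p] by (auto simp: less_eq_div_iff_mult_less_eq mult.commute Suc_le_eq)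
      show "\<forall>d\<in>{1..n} - (\<lambda>e. p * e) ` {1..n div p}. (w ^ multiplicity p d - 1) * W d = 0"
      proof
        fix d assume d: "d \<in> {1..n} - (\<lambda>e. p * e) ` {1..n div p}"
        have "\<not> p dvd d"
        proof
          assume "p dvd d"
          then obtain k where k: "d = p * k" by auto
          with d prime_gt_0_nat[OF p] have "k \<in> {1..n div p}"
            by (auto simp: less_eq_div_iff_mult_less_eq mult.commute Suc_le_eq)
          with d k show False by auto
        qed
        then show "(w ^ multiplicity p d - 1) * W d = 0" by (simp add: not_dvd_imp_multiplicity_0)
      qed
    qed simp
    also have "\<dots> = (\<Sum>e=1..n div p. (w ^ multiplicity p (p * e) - 1) * W (p * e))"
      using prime_gt_0_nat[OF p] by (subst sum.reindex) (auto simp: inj_on_def)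
    also have "\<dots> = (\<Sum>e=1..n div p. (w - 1) * W e + w * ((w ^ multiplicity p e - 1) * W e))"
    proof (rule sum.cong)
      fix e assume "e \<in> {1..n div p}"
      then have e: "e > 0" by simp
      then have "multiplicity p (p * e) = Suc (multiplicity p e)"
        using prime_gt_1_nat[OF p] by (intro multiplicity_times_same) auto
      then show "(w ^ multiplicity p (p * e) - 1) * W (p * e) =
          (w - 1) * W e + w * ((w ^ multiplicity p e - 1) * W e)"
        by (subst Wp[OF e]) (simp add: algebra_simps)
    qed simp
    finally show ?thesis by (simp add: sum.distrib sum_distrib_left D_def)
  qed
  \<comment> \<open>The coefficient is the fixed point of the recursion:
    \<open>(w - 1) * c + w * (c * (w - 1) / (p - w))\<close> equals \<open>p\<close> times
    \<open>c * (w - 1) / (p - w)\<close>.\<close>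
  have D: "D n \<le> real n * (c * (w - 1) / (real p - w))" for n
  proof (induction n rule: less_induct)
    case (less n)
    show ?case
    proof (cases "n = 0")
      case False
      then have "n div p < n" using prime_gt_1_nat[OF p] by simp
      let ?m = "real (n div p)"
      have "D n \<le> (w - 1) * (?m * c) + w * (?m * (c * (w - 1) / (real p - w)))"
        unfolding D_rec[of n] using G[of "n div p"] less.IH[OF \<open>n div p < n\<close>] assms
        by (intro add_mono mult_left_mono) auto
      also have "\<dots> = ?m * real p * (c * (w - 1) / (real p - w))"
        using p2 assms by (simp add: field_simps)
      also have "\<dots> \<le> real n * (c * (w - 1) / (real p - w))"
      proof (intro mult_right_mono)
        show "?m * real p \<le> real n"
          by (metis div_times_less_eq_dividend of_nat_le_iff of_nat_mult)
      qed (use p2 assms c0 in auto)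
      finally show ?thesis .
    qed (simp add: D_def)
  qed
  have "(\<Sum>d=1..n. w ^ (\<Sum>q\<in>insert p P. multiplicity q d)) = (\<Sum>d=1..n. W d) + D n"
    using insert by (simp add: W_def D_def power_add algebra_simps flip: sum.distrib)
  also have "\<dots> \<le> real n * c + real n * (c * (w - 1) / (real p - w))"
    using G D by (intro add_mono) auto
  also have "\<dots> = real n * (\<Prod>p\<in>insert p P. 1 + (w - 1) / (real p - w))"
    using insert by (simp add: c_def algebra_simps)
  finally show ?case .
qed simp

lemma sum_multiplicity_eq_prime_Omega:
  assumes "d \<ge> 1" "\<And>p. prime p \<Longrightarrow> p dvd d \<Longrightarrow> real p \<le> y"
  shows "(\<Sum>p\<in>primes_between 0 y. multiplicity p d) = prime_Omega d"
proof -
  have "prime_Omega d = (\<Sum>p\<in>prime_factors d. multiplicity p d)"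
    unfolding prime_Omega_def size_multiset_overloaded_eq
    by (intro sum.cong refl) (auto simp: count_prime_factorization_prime dest: in_prime_factors_imp_prime)
  also have "\<dots> = (\<Sum>p\<in>primes_between 0 y. multiplicity p d)"
  proof (rule sum.mono_neutral_left)
    show "prime_factors d \<subseteq> primes_between 0 y"
      using assms by (auto simp: primes_between_def in_prime_factors_iff prime_gt_0_nat)
    show "\<forall>i\<in>primes_between 0 y - prime_factors d. multiplicity i d = 0"
      using assms by (auto simp: primes_between_def in_prime_factors_iff not_dvd_imp_multiplicity_0)
  qed simp
  finally show ?thesis by simp
qed

text \<open>One has \<open>1 / (p - w) = 1 / p + w / (p * (p - w))\<close>, and the second term is
  summable. It is majorised by \<open>12 * ln p / (p * (p - 1))\<close> so that the sum already
  bounded for Mertens' estimate can serve again.\<close>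

lemma prod_primes_le_exp:
  "\<exists>C\<ge>0. \<forall>y\<ge>2. \<forall>w. 1 \<le> w \<and> w \<le> 3 / 2 \<longrightarrow>
     (\<Prod>p\<in>primes_between 0 y. 1 + (w - 1) / (real p - w)) \<le> exp ((w - 1) * (ln (ln y) + C))"
proof (intro exI conjI allI impI)
  \<comment> \<open>The 1/2 is the reciprocal of the prime 2, the logarithmic terms come from
    \<open>sum_inverse_primes_le\<close> at \<open>a = 2\<close>, and \<open>24 = 12 * 2\<close>
    from the convergent sum.\<close>
  let ?C = "1 / 2 - ln (ln 2) + 30 / ln 2 + 24 :: real"
  have "ln (ln 2 :: real) \<le> 0" using ln_2_less_1 ln_le_zero_iff[of "ln 2"] by simp
  moreover have "30 / ln 2 \<ge> (0 :: real)" by simp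
  ultimately show "?C \<ge> 0" by linarith
  fix y w :: real assume y: "y \<ge> 2" and w: "1 \<le> w \<and> w \<le> 3 / 2"
  let ?P = "primes_between 0 y"
  have "(\<Prod>p\<in>?P. 1 + (w - 1) / (real p - w)) \<le>
      (\<Prod>p\<in>?P. exp ((w - 1) * (1 / real p + 12 * (ln (real p) / (real p * (real p - 1))))))"
  proof (intro prod_mono conjI)
    fix p assume "p \<in> ?P"
    then have p: "real p \<ge> 2" by (rule primes_between_gt_1)
    show "0 \<le> 1 + (w - 1) / (real p - w)" using p w by (intro add_nonneg_nonneg divide_nonneg_nonneg) auto
    have "1 + (w - 1) / (real p - w) \<le> exp ((w - 1) * (1 / (real p - w)))"
      using exp_ge_add_one_self[of "(w - 1) * (1 / (real p - w))"] by simp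
    also have "\<dots> \<le> exp ((w - 1) * (1 / real p + 12 * (ln (real p) / (real p * (real p - 1)))))"
    proof -
      have "1 / (real p - w) = 1 / real p + w / (real p * (real p - w))"
        using p w by (simp add: field_simps)
      also have "w / (real p * (real p - w)) \<le> 12 * (ln (real p) / (real p * (real p - 1)))"
      proof -
        have "ln 2 \<le> ln (real p)" using p by (intro ln_mono) auto
        then have l: "1 / 2 \<le> ln (real p)" using ln2_ge_two_thirds by linarith
        have "w / (real p * (real p - w)) \<le> (3 / 2) / (real p * ((real p - 1) / 4))"
          using p w by (intro frac_le mult_left_mono) auto
        also have "\<dots> = 12 * ((1 / 2) / (real p * (real p - 1)))" using p by (simp add: field_simps)
        also have "\<dots> \<le> 12 * (ln (real p) / (real p * (real p - 1)))"
          using p l by (intro mult_left_mono divide_right_mono) auto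
        finally show ?thesis .
      qed
      finally have "1 / (real p - w) \<le> 1 / real p + 12 * (ln (real p) / (real p * (real p - 1)))" by simp
      then show ?thesis using w by (intro iffD2[OF exp_le_cancel_iff] mult_left_mono) auto
    qed
    finally show "1 + (w - 1) / (real p - w) \<le>
       exp ((w - 1) * (1 / real p + 12 * (ln (real p) / (real p * (real p - 1)))))" .
  qed
  also have "\<dots> = exp ((w - 1) * ((\<Sum>p\<in>?P. 1 / real p) + 12 * (\<Sum>p\<in>?P. ln (real p) / (real p * (real p - 1)))))"
    by (simp only: exp_sum[symmetric] finite_primes_between sum_distrib_left sum.distrib distrib_left)
  also have "\<dots> \<le> exp ((w - 1) * (ln (ln y) + ?C))"
  proof -
    have "(\<Sum>p\<in>?P. 1 / real p) = (\<Sum>p\<in>primes_between 0 2. 1 / real p) + (\<Sum>p\<in>primes_between 2 y. 1 / real p)"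
      using y by (intro sum_primes_between_split) auto
    also have "primes_between 0 2 = {2}"
      by (auto simp: primes_between_def dest: prime_ge_2_nat)
    finally have "(\<Sum>p\<in>?P. 1 / real p) \<le> 1 / 2 + (ln (ln y) - ln (ln 2) + 30 / ln 2)"
      using sum_inverse_primes_le[of 2 y] y by simp
    moreover have "(\<Sum>p\<in>?P. ln (real p) / (real p * (real p - 1))) \<le> 2"
      using sum_ln_over_prime_mult_pred_le[of "nat \<lfloor>y\<rfloor>"] primes_between_floor[of y 0] y by simp
    ultimately show ?thesis using w by (intro iffD2[OF exp_le_cancel_iff] mult_left_mono) auto
  qed
  finally show "(\<Prod>p\<in>?P. 1 + (w - 1) / (real p - w)) \<le> exp ((w - 1) * (ln (ln y) + ?C))" .
qed

text \<open>Rankin's trick: each counted \<open>d\<close> has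
  \<open>w powr (prime_Omega d - K) >= 1\<close>. The bound is linear in \<open>X\<close> and
  uniform for \<open>X <= y\<close>, so it can be summed with \<open>X = min y (x / m)\<close>;
  \<open>w\<close> stays free and is later taken as \<open>1 + d\<close> and as
  \<open>3 / 2\<close>.\<close>

lemma card_prime_Omega_ge_le:
  "\<exists>C\<ge>0. \<forall>y\<ge>2. \<forall>w. 1 \<le> w \<and> w \<le> 3 / 2 \<longrightarrow> (\<forall>X K. 0 \<le> X \<and> X \<le> y \<longrightarrow>
     real (card {d. 1 \<le> d \<and> real d \<le> X \<and> K \<le> real (prime_Omega d)}) \<le>
       w powr (- K) * exp ((w - 1) * (ln (ln y) + C)) * X)"
proof -
  obtain C where C: "C \<ge> 0" "\<And>y w. y \<ge> 2 \<Longrightarrow> 1 \<le> w \<Longrightarrow> w \<le> 3 / 2 \<Longrightarrow>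
     (\<Prod>p\<in>primes_between 0 y. 1 + (w - 1) / (real p - w)) \<le> exp ((w - 1) * (ln (ln y) + C))"
    using prod_primes_le_exp by blast
  show ?thesis
  proof (intro exI[of _ C] conjI allI impI)
    fix y w X K :: real assume y: "y \<ge> 2" and w: "1 \<le> w \<and> w \<le> 3 / 2" and X: "0 \<le> X \<and> X \<le> y"
    let ?D = "{d. 1 \<le> d \<and> real d \<le> X \<and> K \<le> real (prime_Omega d)}"
    let ?n = "nat \<lfloor>X\<rfloor>"
    have sub: "?D \<subseteq> {1..?n}" by (auto simp: le_nat_floor)
    then have fin: "finite ?D" by (rule finite_subset) simp
    have "w powr K * real (card ?D) = (\<Sum>d\<in>?D. w powr K)" by simp
    also have "\<dots> \<le> (\<Sum>d\<in>?D. w ^ (\<Sum>p\<in>primes_between 0 y. multiplicity p d))"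
    proof (rule sum_mono)
      fix d assume d: "d \<in> ?D"
      have "w powr K \<le> w powr real (prime_Omega d)" using d w by (intro powr_mono) auto
      also have "\<dots> = w ^ prime_Omega d" using w by (simp add: powr_realpow)
      also have "prime_Omega d = (\<Sum>p\<in>primes_between 0 y. multiplicity p d)"
      proof (rule sum_multiplicity_eq_prime_Omega[symmetric])
        fix p assume "prime p" "p dvd d"
        then have "p \<le> d" using d by (auto dest: dvd_imp_le)
        then have "real p \<le> real d" by simp
        then show "real p \<le> y" using d X by simp
      qed (use d in auto)
      finally show "w powr K \<le> w ^ (\<Sum>p\<in>primes_between 0 y. multiplicity p d)" .
    qed
    also have "\<dots> \<le> (\<Sum>d=1..?n. w ^ (\<Sum>p\<in>primes_between 0 y. multiplicity p d))"
      using w sub by (intro sum_mono2) auto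
    also have "\<dots> \<le> real ?n * (\<Prod>p\<in>primes_between 0 y. 1 + (w - 1) / (real p - w))"
      using w by (intro sum_power_multiplicity_le finite_primes_between) (auto simp: primes_between_def)
    also have "\<dots> \<le> X * exp ((w - 1) * (ln (ln y) + C))"
    proof (rule mult_mono)
      show "(\<Prod>p\<in>primes_between 0 y. 1 + (w - 1) / (real p - w)) \<le> exp ((w - 1) * (ln (ln y) + C))"
        using C(2) w y by blast
      show "0 \<le> (\<Prod>p\<in>primes_between 0 y. 1 + (w - 1) / (real p - w))"
      proof (intro prod_nonneg ballI)
        fix p assume "p \<in> primes_between 0 y"
        then have "real p \<ge> 2" by (rule primes_between_gt_1)
        then show "0 \<le> 1 + (w - 1) / (real p - w)" using w by (intro add_nonneg_nonneg divide_nonneg_nonneg) auto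
      qed
    qed (use X in auto)
    finally have "w powr K * real (card ?D) \<le> X * exp ((w - 1) * (ln (ln y) + C))" .
    then have "w powr (- K) * (w powr K * real (card ?D)) \<le> w powr (- K) * (X * exp ((w - 1) * (ln (ln y) + C)))"
      by (intro mult_left_mono) auto
    also have "w powr (- K) * (w powr K * real (card ?D)) = real (card ?D)"
      using w by (simp add: powr_minus field_simps)
    finally show "real (card ?D) \<le> w powr (- K) * exp ((w - 1) * (ln (ln y) + C)) * X"
      by (simp add: mult_ac)
  qed (rule C(1))
qed

section \<open>Rough numbers\<close>

definition rough :: "real \<Rightarrow> nat \<Rightarrow> bool" where
  "rough z m \<longleftrightarrow> (\<forall>p. prime p \<longrightarrow> p dvd m \<longrightarrow> z < real p)"

lemma rough_coprime:
  assumes "rough z m" "\<And>p. prime p \<Longrightarrow> p dvd k \<Longrightarrow> real p \<le> z"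
  shows "coprime m k"
proof (rule ccontr)
  assume "\<not> coprime m k"
  then have "gcd m k \<noteq> 1" using coprime_iff_gcd_eq_1 by blast
  then obtain p where "prime p" "p dvd gcd m k" using prime_factor_nat by blast
  then have "z < real p" "real p \<le> z" using assms by (auto simp: rough_def)
  then show False by simp
qed

text \<open>Each rough factor is coprime to the other small cofactor, so the two rough factors
  divide one another.\<close>

lemma rough_decomposition_unique:
  assumes "rough z m" "rough z m'" "m * k = m' * k'" "m > 0"
    and "\<And>p. prime p \<Longrightarrow> p dvd k \<Longrightarrow> real p \<le> z" "\<And>p. prime p \<Longrightarrow> p dvd k' \<Longrightarrow> real p \<le> z"
  shows "m = m'" "k = k'"
proof -
  have "m dvd m'" using rough_coprime[OF assms(1,6)] assms(3) by (metis coprime_dvd_mult_left_iff dvd_triv_left)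
  moreover have "m' dvd m" using rough_coprime[OF assms(2,5)] assms(3) by (metis coprime_dvd_mult_left_iff dvd_triv_left)
  ultimately show "m = m'" by (simp add: dvd_antisym)
  then show "k = k'" using assms by simp
qed

definition rough_sum :: "real \<Rightarrow> real \<Rightarrow> real \<Rightarrow> real \<Rightarrow> real" where
  "rough_sum z A x y = (\<Sum>m\<in>smooth_set x y. if rough z m then min A (x / real m) else 0)"

text \<open>All primes of an integer \<open>k <= z\<close> are at most \<open>z\<close>, so the
  product \<open>m * k\<close> determines both \<open>k\<close> and the rough \<open>m\<close>.
  These products lie in \<open>smooth_set x y\<close>, and rounding
  \<open>min z (x / m) >= 1\<close> down costs at most a factor 2; no logarithm is lost.\<close>

lemma rough_sum_base:
  assumes "1 \<le> z" "z \<le> y"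
  shows "rough_sum z z x y \<le> 2 * real (smooth_count x y)"
proof -
  let ?M = "{m \<in> smooth_set x y. rough z m}"
  let ?N = "\<lambda>m. {1..nat \<lfloor>min z (x / real m)\<rfloor>}"
  have k: "real k \<le> z \<and> k \<ge> 1 \<and> real k \<le> x / real m \<and> (\<forall>p. prime p \<longrightarrow> p dvd k \<longrightarrow> real p \<le> z)" if "k \<in> ?N m" for k m
  proof -
    from that have "int k \<le> \<lfloor>min z (x / real m)\<rfloor>" "k \<ge> 1" by auto
    then have k: "real k \<le> min z (x / real m)" "k \<ge> 1" by (simp_all add: le_floor_iff)
    moreover have "real p \<le> z" if "prime p" "p dvd k" for p
    proof -
      have "p \<le> k" using that k by (auto dest: dvd_imp_le)
      then have "real p \<le> real k" by simp
      then show ?thesis using k by simp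
    qed
    ultimately show ?thesis by auto
  qed
  have "rough_sum z z x y = (\<Sum>m\<in>?M. min z (x / real m))"
    unfolding rough_sum_def by (simp add: sum.inter_filter)
  also have "\<dots> \<le> (\<Sum>m\<in>?M. 2 * real (card (?N m)))"
  proof (rule sum_mono)
    fix m assume m: "m \<in> ?M"
    then have "1 \<le> x / real m" using smooth_set_pos by (auto simp: field_simps dest: smooth_set_pos)
    then have "min z (x / real m) \<ge> 1" using assms by auto
    then have "\<lfloor>min z (x / real m)\<rfloor> \<ge> 1" by (subst le_floor_iff) simp
    then have "real (card (?N m)) \<ge> 1" "real (card (?N m)) = of_int \<lfloor>min z (x / real m)\<rfloor>" by auto
    then show "min z (x / real m) \<le> 2 * real (card (?N m))"
      using real_of_int_floor_add_one_gt[of "min z (x / real m)"] by linarith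
  qed
  also have "\<dots> = 2 * real (card (Sigma ?M ?N))"
    by (subst card_SigmaI) (auto simp: sum_distrib_left)
  also have "card (Sigma ?M ?N) \<le> card (smooth_set x y)"
  proof (rule card_inj_on_le[where f = "\<lambda>(m, k). m * k"])
    show "inj_on (\<lambda>(m, k). m * k) (Sigma ?M ?N)"
    proof (rule inj_onI, clarify)
      fix m l m' l'
      assume "m \<in> smooth_set x y" "l \<in> ?N m" "rough z m" "m' \<in> smooth_set x y" "l' \<in> ?N m'" "rough z m'" "m * l = m' * l'"
      then show "m = m' \<and> l = l'"
        using rough_decomposition_unique[of z m m' l l'] k[of l m] k[of l' m'] smooth_set_pos[of m x y] by auto
    qed
    show "(\<lambda>(m, k). m * k) ` Sigma ?M ?N \<subseteq> smooth_set x y"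
    proof clarify
      fix m l assume ml: "m \<in> smooth_set x y" "l \<in> ?N m" "rough z m"
      have "l \<in> smooth_set (x / real m) y" using k[OF ml(2)] assms by (auto simp: smooth_set_iff)
      moreover have "m \<in> smooth_set (real m) y" "m > 0" using ml assms by (auto simp: smooth_set_iff)
      ultimately show "m * l \<in> smooth_set x y"
        using assms by (intro smooth_set_mult[of y m "real m" l "x / real m"]) auto
    qed
  qed simp
  finally show ?thesis by (simp add: smooth_count_def)
qed

text \<open>This loses only a factor \<open>(ln y / ln z)\<^sup>2\<close>, while the trivial bound \<open>truncated_sum y x y\<close>
  is larger by \<open>ln y\<close>: rough numbers have density \<open>1 / ln z\<close>.\<close>

lemma rough_sum_le:
  assumes z: "56 \<le> ln z" "1 < z" "z \<le> y" and x: "x \<ge> 1"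
  shows "rough_sum z y x y \<le> (2 + 16 * ln y * ln x / (ln z)\<^sup>2) * real (smooth_count x y)"
proof -
  let ?Q = "primes_between (sqrt z) y"
  define c where "c = ln z / (4 * ln y)"
  have c: "c > 0" using z by (simp add: c_def)
  have sz: "sqrt z > 1" "sqrt z \<le> z" using z by (auto simp: power2_eq_square intro!: real_le_lsqrt)
  \<comment> \<open>For \<open>q > X / z\<close> the minimum is \<open>X / q\<close>, so the
    reciprocals of these primes give the bound. The requirement \<open>q > sqrt z\<close> limits how
    many of these primes can divide a number up to \<open>x\<close> in the later double
    counting.\<close>
  have key: "c * X \<le> (\<Sum>q\<in>primes_between (sqrt z) X. min z (X / real q))" if X: "z \<le> X" "X \<le> y" for X
  proof -
    let ?b = "max (sqrt z) (X / z)"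
    have b: "1 \<le> ?b" "?b \<le> X" using X z sz by (auto simp: field_simps le_max_iff_disj mult_le_cancel_left1)
    have "ln ?b \<le> ln X - ln z / 2"
    proof -
      have "ln (sqrt z) = ln z / 2" using z by (simp add: ln_sqrt)
      moreover have "ln (X / z) = ln X - ln z" using X z by (simp add: ln_div)
      moreover have "ln z \<le> ln X" using X z by (intro ln_mono) auto
      ultimately show ?thesis using z by (auto simp: max_def)
    qed
    \<comment> \<open>Here \<open>56 = 4 * 14\<close>: the error 14 from Mertens takes at most half
      of \<open>ln z / 2\<close>.\<close>
    then have "ln z / 4 \<le> ln X - ln ?b - 14" using z by simp
    then have "ln z / 4 / ln y \<le> (ln X - ln ?b - 14) / ln X"
      using X z by (intro frac_le ln_mono) auto
    also have "\<dots> \<le> (\<Sum>q\<in>primes_between ?b X. 1 / real q)"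
      using b X z by (intro sum_inverse_primes_ge) auto
    finally have "c * X \<le> (\<Sum>q\<in>primes_between ?b X. 1 / real q) * X"
      using X z by (intro mult_right_mono) (auto simp: c_def)
    also have "\<dots> = (\<Sum>q\<in>primes_between ?b X. X / real q)" by (simp add: sum_distrib_right)
    also have "\<dots> \<le> (\<Sum>q\<in>primes_between ?b X. min z (X / real q))"
    proof (rule sum_mono)
      fix q assume "q \<in> primes_between ?b X"
      then have "X / z < real q" "real q > 0" by (auto simp: primes_between_def prime_gt_0_nat)
      then show "X / real q \<le> min z (X / real q)" using z by (simp add: field_simps)
    qed
    also have "\<dots> \<le> (\<Sum>q\<in>primes_between (sqrt z) X. min z (X / real q))"
    proof (rule sum_mono2)
      show "primes_between ?b X \<subseteq> primes_between (sqrt z) X" by (auto simp: primes_between_def)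
    qed (use X z in auto)
    finally show ?thesis .
  qed
  have "c * rough_sum z y x y \<le> (\<Sum>m\<in>smooth_set x y. c * (if rough z m then min z (x / real m) else 0) +
      (\<Sum>q | q \<in> ?Q \<and> real q \<le> x / real m. if rough z m then min z (x / real q / real m) else 0))"
    unfolding rough_sum_def sum_distrib_left
  proof (rule sum_mono)
    fix m assume "m \<in> smooth_set x y"
    then have m: "m \<ge> 1" "real m \<le> x" using smooth_set_pos by auto
    let ?X = "x / real m"
    have X: "?X \<ge> 1" using m by simp
    have nonneg: "0 \<le> (\<Sum>q | q \<in> ?Q \<and> real q \<le> ?X. if rough z m then min z (x / real q / real m) else 0)"
      using z x by (intro sum_nonneg) auto
    show "c * (if rough z m then min y ?X else 0) \<le> c * (if rough z m then min z ?X else 0) +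
      (\<Sum>q | q \<in> ?Q \<and> real q \<le> ?X. if rough z m then min z (x / real q / real m) else 0)"
    proof (cases "rough z m")
      case True
      show ?thesis
      proof (cases "?X \<le> z")
        case True
        then have "min y ?X = min z ?X" using z by auto
        then show ?thesis using nonneg by (simp only: if_True if_False split: if_splits)
      next
        case False
        \<comment> \<open>\<open>key\<close> is available only up to \<open>y\<close>, and the value
          truncated there is also the one to be bounded.\<close>
        define X' where "X' = min y ?X"
        have "c * X' \<le> (\<Sum>q\<in>primes_between (sqrt z) X'. min z (X' / real q))"
          using False z by (intro key) (auto simp: X'_def)
        also have "\<dots> \<le> (\<Sum>q\<in>primes_between (sqrt z) X'. min z (x / real q / real m))"
        proof (intro sum_mono min.mono order_refl)
          fix q
          have "X' / real q \<le> ?X / real q" by (intro divide_right_mono) (auto simp: X'_def)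
          then show "X' / real q \<le> x / real q / real m" by (simp add: mult.commute)
        qed
        also have "primes_between (sqrt z) X' = {q. q \<in> ?Q \<and> real q \<le> ?X}"
          by (auto simp: primes_between_def X'_def)
        finally have "c * min y ?X \<le> (\<Sum>q | q \<in> ?Q \<and> real q \<le> ?X. min z (x / real q / real m))"
          by (simp add: X'_def)
        moreover have "0 \<le> c * min z ?X" using c z X by auto
        ultimately show ?thesis using True by simp
      qed
    qed simp
  qed
  also have "\<dots> = c * rough_sum z z x y + (\<Sum>m\<in>smooth_set x y.
      \<Sum>q | q \<in> ?Q \<and> real q \<le> x / real m. if rough z m then min z (x / real q / real m) else 0)"
    by (simp only: sum.distrib rough_sum_def sum_distrib_left)
  also have "(\<Sum>m\<in>smooth_set x y. \<Sum>q | q \<in> ?Q \<and> real q \<le> x / real m. if rough z m then min z (x / real q / real m) else 0) =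
      (\<Sum>q\<in>?Q. rough_sum z z (x / real q) y)"
    unfolding rough_sum_def using x by (intro sum_primes_smooth_swap) (auto dest: primes_between_gt_1)
  also have "\<dots> \<le> (\<Sum>q\<in>?Q. 2 * real (smooth_count (x / real q) y))"
    using z by (intro sum_mono rough_sum_base) auto
  also have "\<dots> = 2 * (\<Sum>q\<in>?Q. real (smooth_count (x / real q) y))" by (simp add: sum_distrib_left)
  also have "\<dots> \<le> 2 * (ln x / ln (sqrt z) * real (smooth_count x y))"
    using x z sz by (intro mult_left_mono sum_smooth_count_large_primes_le) auto
  also have "c * rough_sum z z x y \<le> c * (2 * real (smooth_count x y))"
    using c z by (intro mult_left_mono rough_sum_base) auto
  also have "c * (2 * real (smooth_count x y)) + 2 * (ln x / ln (sqrt z) * real (smooth_count x y)) =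
      c * ((2 + 16 * ln y * ln x / (ln z)\<^sup>2) * real (smooth_count x y))"
    using z by (simp add: c_def ln_sqrt power2_eq_square) (simp add: field_simps)
  finally show ?thesis using c by simp
qed

section \<open>Smooth numbers with too many prime factors\<close>

text \<open>A finite Euler product: the power of \<open>p\<close> is split off and contributes a
  geometric sum of ratio \<open>l / p < 1\<close>. The set \<open>A\<close> is arbitrary so that the
  induction can pass to the \<open>p\<close>-free parts of its elements.\<close>

lemma sum_power_prime_Omega_over_le:
  fixes l :: real
  assumes "finite Q" "\<And>p. p \<in> Q \<Longrightarrow> prime p \<and> l < real p" "l \<ge> 0"
    and "finite A" "\<And>d. d \<in> A \<Longrightarrow> d > 0 \<and> prime_factors d \<subseteq> Q"
  shows "(\<Sum>d\<in>A. l ^ prime_Omega d / real d) \<le> (\<Prod>p\<in>Q. 1 / (1 - l / real p))"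
  using assms(1,2,4,5)
proof (induction Q arbitrary: A rule: finite_induct)
  case empty
  have "A \<subseteq> {1}"
  proof
    fix d assume "d \<in> A"
    then have "d > 0" "prime_factorization d = {#}" using empty.prems by auto
    then show "d \<in> {1}" by (simp add: prime_factorization_empty_iff)
  qed
  then have "A = {} \<or> A = {1}" by auto
  then show ?case by (auto simp: prime_Omega_def)
next
  case (insert p Q)
  have p: "prime p" "l < real p" using insert.prems by auto
  let ?g = "\<lambda>d. l ^ prime_Omega d / real d"
  define r where "r = l / real p"
  have r: "0 \<le> r" "r < 1" using p assms by (auto simp: r_def field_simps)
  let ?j = "\<lambda>d. multiplicity p d"
  let ?c = "\<lambda>d. d div p ^ multiplicity p d"
  define J where "J = Max (insert 0 (?j ` A))"
  have dec: "d = p ^ ?j d * ?c d" for d by (simp add: multiplicity_dvd)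
  have cpos: "?c d > 0" if "d \<in> A" for d
    using dec[of d] insert.prems(3)[OF that] by (metis mult_0_right neq0_conv)
  have g: "?g d = r ^ ?j d * ?g (?c d)" if "d \<in> A" for d
  proof -
    have "prime_Omega (p ^ j) = j" for j
      by (induction j) (use p in \<open>auto simp: prime_Omega_mult prime_Omega_prime prime_gt_0_nat, simp add: prime_Omega_def\<close>)
    then have "prime_Omega d = ?j d + prime_Omega (?c d)"
      using dec[of d] cpos[OF that] p by (metis prime_Omega_mult prime_gt_0_nat zero_less_power)
    moreover have "real d = real p ^ ?j d * real (?c d)"
      using dec[of d] by (metis of_nat_mult of_nat_power)
    ultimately show ?thesis
      by (simp add: r_def power_add power_divide)
  qed
  have "(\<Sum>d\<in>A. ?g d) = (\<Sum>d\<in>A. (\<lambda>(j, c). r ^ j * ?g c) (?j d, ?c d))"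
    using g by (intro sum.cong) auto
  also have "\<dots> = (\<Sum>(j, c)\<in>(\<lambda>d. (?j d, ?c d)) ` A. r ^ j * ?g c)"
  proof (subst sum.reindex)
    show "inj_on (\<lambda>d. (?j d, ?c d)) A"
      by (rule inj_onI) (metis dec prod.inject)
  qed (simp add: o_def)
  also have "\<dots> \<le> (\<Sum>(j, c)\<in>{..J} \<times> ?c ` A. r ^ j * ?g c)"
  proof (rule sum_mono2)
    show "(\<lambda>d. (?j d, ?c d)) ` A \<subseteq> {..J} \<times> ?c ` A"
      using insert.prems(2) by (auto simp: J_def intro!: Max_ge)
  qed (use insert.prems r assms in auto)
  also have "\<dots> = (\<Sum>j\<le>J. r ^ j) * (\<Sum>c\<in>?c ` A. ?g c)"
    by (simp add: sum_product sum.cartesian_product)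
  also have "\<dots> \<le> (1 / (1 - r)) * (\<Prod>p\<in>Q. 1 / (1 - l / real p))"
  proof (rule mult_mono)
    have "(\<Sum>j\<le>J. r ^ j) = (\<Sum>j<Suc J. r ^ j)" by (simp only: lessThan_Suc_atMost)
    also have "\<dots> = (1 - r ^ Suc J) / (1 - r)" using r by (simp only: sum_gp_strict) simp
    also have "\<dots> \<le> 1 / (1 - r)" using r by (intro divide_right_mono) auto
    finally show "(\<Sum>j\<le>J. r ^ j) \<le> 1 / (1 - r)" .
    show "(\<Sum>c\<in>?c ` A. ?g c) \<le> (\<Prod>p\<in>Q. 1 / (1 - l / real p))"
    proof (rule insert.IH)
      fix c assume "c \<in> ?c ` A"
      then obtain d where d: "d \<in> A" "c = ?c d" by auto
      have "c dvd d" using dec[of d] d by (metis dvd_triv_right)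
      have "\<not> p dvd c"
      proof
        assume "p dvd c"
        then have "p ^ Suc (?j d) dvd d" using dec[of d] d by (metis mult_dvd_mono dvd_refl power_Suc2)
        moreover have "d > 0" using insert.prems d by auto
        ultimately show False using p prime_gt_1_nat[OF p(1)]
          by (metis Suc_n_not_le_n gr_implies_not0 nat_dvd_1_iff_1 not_prime_1 power_dvd_iff_le_multiplicity)
      qed
      show "0 < c \<and> prime_factors c \<subseteq> Q"
      proof
        show "c > 0" using cpos d by simp
        show "prime_factors c \<subseteq> Q"
        proof
          fix q assume q: "q \<in> prime_factors c"
          then have "q \<noteq> p" using \<open>\<not> p dvd c\<close> by (auto simp: in_prime_factors_iff)
          moreover have "q \<in> prime_factors d"
            using q \<open>c dvd d\<close> insert.prems(3)[OF d(1)] by (auto simp: in_prime_factors_iff intro: dvd_trans)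
          ultimately show "q \<in> Q" using insert.prems(3)[OF d(1)] by auto
        qed
      qed
    qed (use insert.prems in auto)
  qed (use r assms in \<open>auto intro!: sum_nonneg\<close>)
  also have "\<dots> = (\<Prod>p\<in>insert p Q. 1 / (1 - l / real p))"
    using insert by (simp add: r_def)
  finally show ?case .
qed

section \<open>Products of sub-multisets of a prime factorization\<close>

lemma prod_mset_filter_dvd: "n > 0 \<Longrightarrow> M \<subseteq># prime_factorization n \<Longrightarrow> \<Prod>\<^sub># M dvd (n :: nat)"
  using prod_mset_subset_imp_dvd[of M "prime_factorization n"] by simp

lemma prime_factorization_prod_mset_subset:
  assumes "M \<subseteq># prime_factorization (n :: nat)"
  shows "prime_factorization (\<Prod>\<^sub># M) = M"
  using assms by (intro prime_factorization_prod_mset_primes) (auto dest!: mset_subset_eqD)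

lemma prod_mset_le_power:
  assumes "\<And>p. p \<in># M \<Longrightarrow> real p \<le> v" "v \<ge> 0"
  shows "real (\<Prod>\<^sub># M) \<le> v ^ size M"
  using assms(1)
proof (induction M)
  case (add p M)
  have "real p * real (\<Prod>\<^sub># M) \<le> v * v ^ size M"
    using add assms(2) by (intro mult_mono) auto
  then show ?case by simp
qed simp

lemma power_le_prod_mset:
  assumes "\<And>p. p \<in># M \<Longrightarrow> v \<le> real p" "v \<ge> 0"
  shows "v ^ size M \<le> real (\<Prod>\<^sub># M)"
  using assms(1)
proof (induction M)
  case (add p M)
  have "v * v ^ size M \<le> real p * real (\<Prod>\<^sub># M)"
    using add assms(2) by (intro mult_mono) auto
  then show ?case by simp
qed simp

lemma sub_mset_of_size:
  assumes "k \<le> size M"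
  shows "\<exists>N. N \<subseteq># M \<and> size N = k"
  using assms
proof (induction M arbitrary: k)
  case (add p M)
  show ?case
  proof (cases "k \<le> size M")
    case True
    then obtain N where "N \<subseteq># M" "size N = k" using add.IH by blast
    then show ?thesis by (intro exI[of _ N]) (auto intro: subset_mset.order_trans)
  next
    case False
    then have "k = size (add_mset p M)" using add.prems by simp
    then show ?thesis by blast
  qed
qed simp

text \<open>Such an \<open>n\<close> is divisible by a product \<open>P\<close> of exactly
  \<open>k\<close> medium primes. Exactness gives \<open>P <= v ^ k <= B\<close>, so that
  \<open>smooth_count (x / P) y\<close> is at most \<open>M / P\<close> times
  \<open>smooth_count x y\<close>. The sum of \<open>1 / P\<close> is bounded by Rankin's trick with
  \<open>l ^ (prime_Omega P - k) = 1\<close>, where \<open>2 * l <= z\<close> allows the Euler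
  factors to be replaced by exponentials.\<close>

lemma card_many_medium_primes_le:
  assumes y: "1 \<le> y" "v \<le> y" and l: "0 < l" "2 * l \<le> z"
    and B: "v ^ k \<le> B" "v \<ge> 1" and M: "truncated_sum B x y \<le> M * real (smooth_count x y)"
  shows "real (card {n \<in> smooth_set x y. k \<le> size {#p \<in># prime_factorization n. z < real p \<and> real p \<le> v#}})
     \<le> M * real (smooth_count x y) * (exp (2 * l * (\<Sum>p\<in>primes_between z v. 1 / real p)) / l ^ k)"
proof -
  let ?Q = "primes_between z v"
  define PP where "PP = {P \<in> smooth_set x y. prime_Omega P = k \<and> prime_factors P \<subseteq> ?Q}"
  let ?N = "{n \<in> smooth_set x y. k \<le> size {#p \<in># prime_factorization n. z < real p \<and> real p \<le> v#}}"
  have fin: "finite PP" by (simp add: PP_def)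
  have PP: "P > 0 \<and> prime_factors P \<subseteq> ?Q \<and> prime_Omega P = k \<and> P \<in> smooth_set (real P) y \<and> real P \<le> B" if "P \<in> PP" for P
  proof -
    have 1: "P > 0" "prime_factors P \<subseteq> ?Q" "prime_Omega P = k"
      using that smooth_set_pos by (force simp: PP_def)+
    have "real (\<Prod>\<^sub># (prime_factorization P)) \<le> v ^ size (prime_factorization P)"
      using 1 B by (intro prod_mset_le_power) (auto simp: primes_between_def)
    then have "real P \<le> v ^ k" using 1 by (simp add: prime_Omega_def)
    with 1 B that y show ?thesis by (auto simp: PP_def smooth_set_iff)
  qed
  have "?N \<subseteq> (\<Union>P\<in>PP. {n \<in> smooth_set x y. P dvd n})"
  proof
    fix n assume n: "n \<in> ?N"
    then have npos: "n > 0" using smooth_set_pos by fastforce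
    obtain S where S: "S \<subseteq># {#p \<in># prime_factorization n. z < real p \<and> real p \<le> v#}" "size S = k"
      using n sub_mset_of_size by blast
    have S': "S \<subseteq># prime_factorization n"
      using S(1) multiset_filter_subset subset_mset.order_trans by blast
    have pf: "prime_factorization (\<Prod>\<^sub># S) = S" by (rule prime_factorization_prod_mset_subset[OF S'])
    have dvd: "\<Prod>\<^sub># S dvd n" by (rule prod_mset_filter_dvd[OF npos S'])
    have "\<Prod>\<^sub># S \<in> smooth_set x y" using n dvd y smooth_set_dvd by blast
    moreover have "set_mset S \<subseteq> ?Q"
      using mset_subset_eqD[OF S(1)] by (auto simp: primes_between_def in_prime_factors_iff)
    ultimately have "\<Prod>\<^sub># S \<in> PP" using S pf by (simp add: PP_def prime_Omega_def)
    then show "n \<in> (\<Union>P\<in>PP. {n \<in> smooth_set x y. P dvd n})" using n dvd by blast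
  qed
  then have "card ?N \<le> card (\<Union>P\<in>PP. {n \<in> smooth_set x y. P dvd n})"
    using fin by (intro card_mono) auto
  also have "\<dots> \<le> (\<Sum>P\<in>PP. card {n \<in> smooth_set x y. P dvd n})"
    using fin by (rule card_UN_le)
  finally have "real (card ?N) \<le> real (\<Sum>P\<in>PP. card {n \<in> smooth_set x y. P dvd n})"
    by (rule of_nat_mono)
  also have "\<dots> = (\<Sum>P\<in>PP. real (card {n \<in> smooth_set x y. P dvd n}))"
    by simp
  also have "\<dots> \<le> (\<Sum>P\<in>PP. M * real (smooth_count x y) / l ^ k * (l ^ prime_Omega P / real P))"
  proof (rule sum_mono)
    fix P assume "P \<in> PP"
    note P = PP[OF this]
    have "real P * real (smooth_count (x / real P) y) \<le> truncated_sum (real P) x y"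
      using P by (intro smooth_count_div_le_truncated_sum) auto
    also have "\<dots> \<le> truncated_sum B x y" using P by (intro truncated_sum_mono) auto
    also have "\<dots> \<le> M * real (smooth_count x y)" by (rule M)
    finally have "real (smooth_count (x / real P) y) \<le> M * real (smooth_count x y) / real P"
      using P by (simp add: field_simps)
    moreover have "card {n \<in> smooth_set x y. P dvd n} = smooth_count (x / real P) y"
      using P y by (intro card_smooth_multiples) auto
    ultimately show "real (card {n \<in> smooth_set x y. P dvd n}) \<le> M * real (smooth_count x y) / l ^ k * (l ^ prime_Omega P / real P)"
      using P l by simp
  qed
  also have "\<dots> = M * real (smooth_count x y) / l ^ k * (\<Sum>P\<in>PP. l ^ prime_Omega P / real P)"
    by (simp add: sum_distrib_left)
  also have "\<dots> \<le> M * real (smooth_count x y) / l ^ k * exp (2 * l * (\<Sum>p\<in>?Q. 1 / real p))"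
  proof (rule mult_left_mono)
    have "(\<Sum>P\<in>PP. l ^ prime_Omega P / real P) \<le> (\<Prod>p\<in>?Q. 1 / (1 - l / real p))"
      using l PP fin by (intro sum_power_prime_Omega_over_le finite_primes_between) (auto simp: primes_between_def)
    also have "\<dots> \<le> (\<Prod>p\<in>?Q. exp (2 * l * (1 / real p)))"
    proof (intro prod_mono conjI)
      fix p assume "p \<in> ?Q"
      then have p: "real p > 0" "2 * l < real p" using l by (auto simp: primes_between_def)
      define r where "r = l / real p"
      have r: "0 \<le> r" "2 * r \<le> 1" using p l by (auto simp: r_def field_simps)
      have "1 / (1 - r) \<le> 1 + 2 * r"
      proof -
        have "2 * r * r \<le> 1 * r" using r by (intro mult_right_mono) auto
        then have "1 \<le> (1 + 2 * r) * (1 - r)" by (simp add: algebra_simps)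
        then show ?thesis using r by (simp add: divide_le_eq)
      qed
      also have "\<dots> \<le> exp (2 * r)" by (rule exp_ge_add_one_self)
      finally show "1 / (1 - l / real p) \<le> exp (2 * l * (1 / real p))" by (simp add: r_def)
      show "0 \<le> 1 / (1 - l / real p)" using r by (simp add: r_def)
    qed
    also have "\<dots> = exp (2 * l * (\<Sum>p\<in>?Q. 1 / real p))"
      by (simp add: exp_sum[symmetric] sum_distrib_left)
    finally show "(\<Sum>P\<in>PP. l ^ prime_Omega P / real P) \<le> exp (2 * l * (\<Sum>p\<in>?Q. 1 / real p))" .
    have "0 \<le> truncated_sum B x y"
      unfolding truncated_sum_def
    proof (intro sum_nonneg)
      fix m assume "m \<in> smooth_set x y"
      moreover have "B \<ge> 0" using B zero_le_power[of v k] by linarith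
      ultimately show "0 \<le> min B (x / real m)" using smooth_set_pos[of m x y] by simp
    qed
    with M show "0 \<le> M * real (smooth_count x y) / l ^ k" using l by simp
  qed
  finally show ?thesis by simp
qed

section \<open>Small and large prime factors of a number\<close>

definition smooth_part :: "real \<Rightarrow> nat \<Rightarrow> nat" where
  "smooth_part z n = \<Prod>\<^sub># {#p \<in># prime_factorization n. real p \<le> z#}"

definition rough_part :: "real \<Rightarrow> nat \<Rightarrow> nat" where
  "rough_part z n = \<Prod>\<^sub># {#p \<in># prime_factorization n. \<not> real p \<le> z#}"

lemma rough_part_times_smooth_part: "n > 0 \<Longrightarrow> rough_part z n * smooth_part z n = n"
  unfolding rough_part_def smooth_part_def
  by (metis mult.commute multiset_partition prod_mset.union prod_mset_prime_factorization_nat)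

lemma prime_factorization_smooth_part:
  "prime_factorization (smooth_part z n) = {#p \<in># prime_factorization n. real p \<le> z#}"
  unfolding smooth_part_def by (rule prime_factorization_prod_mset_subset[of _ n]) simp

lemma rough_rough_part: "n > 0 \<Longrightarrow> rough z (rough_part z n)"
proof -
  assume n: "n > 0"
  have "rough_part z n > 0" using rough_part_times_smooth_part[OF n, of z] n by (metis gr0I mult_0)
  moreover have "prime_factorization (rough_part z n) = {#p \<in># prime_factorization n. \<not> real p \<le> z#}"
    unfolding rough_part_def by (rule prime_factorization_prod_mset_subset[of _ n]) simp
  ultimately show ?thesis
    unfolding rough_def by (metis (mono_tags, lifting) in_prime_factors_iff mem_Collect_eq neq0_conv not_le set_mset_filter)
qed

text \<open>Write \<open>n = m * d\<close> with \<open>d\<close> the smooth part. For fixed rough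
  \<open>m\<close> the hypothesis is applied with \<open>X = min y (x / m)\<close>, and summing this
  value over \<open>m\<close> gives \<open>rough_sum\<close> rather than the larger
  \<open>truncated_sum\<close>.\<close>

lemma card_smooth_part_many_factors_le:
  assumes "y \<ge> 1" "x \<ge> 0"
    and B: "\<And>X. 0 \<le> X \<Longrightarrow> X \<le> y \<Longrightarrow> real (card {d. 1 \<le> d \<and> real d \<le> X \<and> K \<le> real (prime_Omega d)}) \<le> b * X"
  shows "real (card {n \<in> smooth_set x y. real (smooth_part z n) \<le> y \<and> K \<le> real (prime_Omega (smooth_part z n))})
    \<le> b * rough_sum z y x y"
proof -
  let ?N = "{n \<in> smooth_set x y. real (smooth_part z n) \<le> y \<and> K \<le> real (prime_Omega (smooth_part z n))}"
  let ?M = "{m \<in> smooth_set x y. rough z m}"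
  let ?D = "\<lambda>m. {d. 1 \<le> d \<and> real d \<le> min y (x / real m) \<and> K \<le> real (prime_Omega d)}"
  have finD: "finite (?D m)" for m
    by (rule finite_subset[of _ "{..nat \<lfloor>y\<rfloor>}"]) (auto simp: le_nat_floor)
  have "?N \<subseteq> (\<lambda>(m, d). m * d) ` Sigma ?M ?D"
  proof
    fix n assume n: "n \<in> ?N"
    then have npos: "n > 0" using smooth_set_pos by fastforce
    let ?m = "rough_part z n" and ?d = "smooth_part z n"
    have eq: "?m * ?d = n" by (rule rough_part_times_smooth_part[OF npos])
    then have pos: "?m > 0" "?d > 0" using npos by (metis gr0I mult_0 mult_0_right)+
    have "?m dvd n" using eq by (metis dvd_triv_left)
    then have "?m \<in> smooth_set x y" using n assms smooth_set_dvd by blast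
    then have "?m \<in> ?M" using rough_rough_part[OF npos] by simp
    moreover have "real ?m * real ?d \<le> x"
      using eq n smooth_set_pos by (metis (no_types, lifting) mem_Collect_eq of_nat_mult)
    then have "real ?d \<le> x / real ?m" using pos by (simp add: field_simps)
    then have "?d \<in> ?D ?m" using n pos by auto
    ultimately have "(?m, ?d) \<in> Sigma ?M ?D" by blast
    then have "(\<lambda>(m, d). m * d) (?m, ?d) \<in> (\<lambda>(m, d). m * d) ` Sigma ?M ?D" by (rule imageI)
    then show "n \<in> (\<lambda>(m, d). m * d) ` Sigma ?M ?D" using eq by simp
  qed
  then have "card ?N \<le> card (Sigma ?M ?D)"
    by (rule surj_card_le[rotated]) (use finD in auto)
  also have "\<dots> = (\<Sum>m\<in>?M. card (?D m))"
    using finD by (intro card_SigmaI) auto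
  finally have "real (card ?N) \<le> real (\<Sum>m\<in>?M. card (?D m))" by (rule of_nat_mono)
  also have "\<dots> = (\<Sum>m\<in>?M. real (card (?D m)))" by simp
  also have "\<dots> \<le> (\<Sum>m\<in>?M. b * min y (x / real m))"
    using assms by (intro sum_mono B) auto
  also have "\<dots> = b * rough_sum z y x y"
    unfolding rough_sum_def sum_distrib_left sum.inter_filter[OF finite_smooth_set] by (intro sum.cong) auto
  finally show ?thesis .
qed

text \<open>The largest divisor \<open>e <= y\<close> works: a further prime of \<open>d\<close>
  would carry it beyond \<open>y\<close>, so \<open>e * z > y\<close>, while \<open>e\<close> is at
  most \<open>z ^ prime_Omega e\<close>.\<close>

lemma divisor_just_below:
  assumes d: "real d > y" "d > 0" "\<And>p. prime p \<Longrightarrow> p dvd d \<Longrightarrow> real p \<le> z" and y: "1 < z" "1 \<le> y"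
  shows "\<exists>e. e dvd d \<and> real e \<le> y \<and> (ln y - ln z) / ln z \<le> real (prime_Omega e)"
proof -
  define E where "E = {e. e dvd d \<and> real e \<le> y}"
  have fin: "finite E" and "1 \<in> E" using d y by (auto simp: E_def intro: finite_subset[OF _ finite_divisors_nat[OF d(2)]])
  define e where "e = Max E"
  have e: "e \<in> E" "\<And>e'. e' \<in> E \<Longrightarrow> e' \<le> e"
    using fin \<open>1 \<in> E\<close> unfolding e_def by (auto intro: Max_in)
  then obtain f where f: "d = e * f" by (auto simp: E_def)
  have epos: "e > 0" using f d by auto
  have "f \<noteq> 1" using f e d by (auto simp: E_def)
  then obtain p where p: "prime p" "p dvd f" using prime_factor_nat by blast
  have "e * p dvd d" using f p by auto
  have "e * p > e" using epos prime_gt_1_nat[OF p(1)] by simp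
  then have "e * p \<notin> E" using e(2) by force
  then have "y < real (e * p)" using \<open>e * p dvd d\<close> by (auto simp: E_def)
  also have "\<dots> \<le> real e * z"
  proof -
    have "p dvd d" using f p by auto
    then have "real p \<le> z" using d(3) p by auto
    then show ?thesis by (simp add: mult_left_mono)
  qed
  also have "\<dots> \<le> z ^ prime_Omega e * z"
  proof -
    have "real (\<Prod>\<^sub># (prime_factorization e)) \<le> z ^ size (prime_factorization e)"
    proof (rule prod_mset_le_power)
      fix q assume "q \<in># prime_factorization e"
      then have "prime q" "q dvd d" using f by (auto simp: in_prime_factors_iff)
      then show "real q \<le> z" by (rule d(3))
    qed (use y in auto)
    then show ?thesis using epos y by (simp add: prime_Omega_def)
  qed
  finally have "ln y \<le> ln (z ^ prime_Omega e * z)" using y by (intro ln_mono) auto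
  also have "\<dots> = real (prime_Omega e) * ln z + ln z" using y by (simp add: ln_mult ln_realpow)
  finally have "(ln y - ln z) / ln z \<le> real (prime_Omega e)" using y by (simp add: field_simps)
  then show ?thesis using e by (auto simp: E_def)
qed

text \<open>After removal of a divisor \<open>e <= y\<close> of the smooth part, the cofactor may
  still contain primes up to \<open>z\<close>, so only the lossy \<open>truncated_sum\<close> is
  available. The many prime factors of \<open>e\<close> make up for that.\<close>

lemma card_large_smooth_part_le:
  assumes "y \<ge> 1" "x \<ge> 0" "1 < z"
    and B: "\<And>X. 0 \<le> X \<Longrightarrow> X \<le> y \<Longrightarrow>
      real (card {d. 1 \<le> d \<and> real d \<le> X \<and> (ln y - ln z) / ln z \<le> real (prime_Omega d)}) \<le> b * X"
  shows "real (card {n \<in> smooth_set x y. real (smooth_part z n) > y}) \<le> b * truncated_sum y x y"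
proof -
  let ?N = "{n \<in> smooth_set x y. real (smooth_part z n) > y}"
  let ?M = "smooth_set x y"
  let ?D = "\<lambda>m. {d. 1 \<le> d \<and> real d \<le> min y (x / real m) \<and> (ln y - ln z) / ln z \<le> real (prime_Omega d)}"
  have finD: "finite (?D m)" for m
    by (rule finite_subset[of _ "{..nat \<lfloor>y\<rfloor>}"]) (auto simp: le_nat_floor)
  have "?N \<subseteq> (\<lambda>(m, d). m * d) ` Sigma ?M ?D"
  proof
    fix n assume n: "n \<in> ?N"
    then have npos: "n > 0" using smooth_set_pos by fastforce
    let ?d = "smooth_part z n"
    have "?d dvd n" using rough_part_times_smooth_part[OF npos, of z] by (metis dvd_triv_right)
    then have dpos: "?d > 0" using npos by (auto intro: dvd_pos_nat)
    have "real p \<le> z" if "prime p" "p dvd ?d" for p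
    proof -
      have "p \<in># prime_factorization ?d" using that dpos by (simp add: in_prime_factors_iff)
      then show ?thesis by (simp add: prime_factorization_smooth_part)
    qed
    then obtain e where e: "e dvd ?d" "real e \<le> y" "(ln y - ln z) / ln z \<le> real (prime_Omega e)"
      using divisor_just_below[of y ?d z] n dpos assms by auto
    have "e dvd n" using e \<open>?d dvd n\<close> dvd_trans by blast
    then obtain m where m: "n = m * e" by (metis dvdE mult.commute)
    then have pos: "m > 0" "e > 0" using npos by auto
    have "m dvd n" using m by simp
    then have "m \<in> ?M" using n assms smooth_set_dvd by blast
    moreover have "real m * real e \<le> x" using m n smooth_set_pos by fastforce
    then have "real e \<le> x / real m" using pos by (simp add: field_simps)
    then have "e \<in> ?D m" using e pos by auto
    ultimately have "(m, e) \<in> Sigma ?M ?D" by blast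
    then have "(\<lambda>(m, d). m * d) (m, e) \<in> (\<lambda>(m, d). m * d) ` Sigma ?M ?D" by (rule imageI)
    then show "n \<in> (\<lambda>(m, d). m * d) ` Sigma ?M ?D" using m by simp
  qed
  then have "card ?N \<le> card (Sigma ?M ?D)"
    by (rule surj_card_le[rotated]) (use finD in auto)
  also have "\<dots> = (\<Sum>m\<in>?M. card (?D m))"
    using finD by (intro card_SigmaI) auto
  finally have "real (card ?N) \<le> real (\<Sum>m\<in>?M. card (?D m))" by (rule of_nat_mono)
  also have "\<dots> = (\<Sum>m\<in>?M. real (card (?D m)))" by simp
  also have "\<dots> \<le> (\<Sum>m\<in>?M. b * min y (x / real m))"
    using assms by (intro sum_mono B) auto
  also have "\<dots> = b * truncated_sum y x y"
    unfolding truncated_sum_def by (simp add: sum_distrib_left)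
  finally show ?thesis .
qed

lemma prime_Omega_le_parts:
  assumes "n > 0" "real n \<le> x" "z \<le> v" "v > 1"
  shows "real (prime_Omega n) \<le> real (prime_Omega (smooth_part z n)) +
    real (size {#p \<in># prime_factorization n. z < real p \<and> real p \<le> v#}) + ln x / ln v"
proof -
  let ?F = "prime_factorization n"
  let ?A = "{#p \<in># ?F. real p \<le> z#}" and ?B = "{#p \<in># ?F. z < real p \<and> real p \<le> v#}" and ?C = "{#p \<in># ?F. v < real p#}"
  have "?F = ?A + ?B + ?C"
    using assms(3) by (intro multiset_eqI) auto
  then have "size ?F = size ?A + size ?B + size ?C" by (metis size_union)
  moreover have "real (size ?C) \<le> ln x / ln v"
  proof -
    have "v ^ size ?C \<le> real (\<Prod>\<^sub># ?C)" using assms by (intro power_le_prod_mset) auto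
    also have "\<Prod>\<^sub># ?C dvd n" by (rule prod_mset_filter_dvd) (use assms in auto)
    then have "real (\<Prod>\<^sub># ?C) \<le> real n" using assms by (intro of_nat_mono dvd_imp_le) auto
    finally have "v ^ size ?C \<le> x" using assms by simp
    then have "ln (v ^ size ?C) \<le> ln x" using assms by (intro ln_mono) auto
    then show ?thesis using assms by (simp add: ln_realpow field_simps)
  qed
  ultimately show ?thesis
    by (simp add: prime_Omega_def prime_factorization_smooth_part)
qed

lemma card_products_few_factors_le:
  assumes y: "y \<ge> 1"
  shows "real (card {n \<in> {a * b | a b. a \<in> smooth_set X y \<and> b \<in> smooth_set X y}. real (prime_Omega n) \<le> K})
    \<le> 2 powr K * (half_sum X y)\<^sup>2"
proof -
  let ?S = "smooth_set X y"
  let ?N = "{n \<in> {a * b | a b. a \<in> ?S \<and> b \<in> ?S}. real (prime_Omega n) \<le> K}"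
  let ?P = "{p \<in> ?S \<times> ?S. real (prime_Omega (fst p * snd p)) \<le> K}"
  have fin: "finite ?P" by simp
  have "?N \<subseteq> (\<lambda>p. fst p * snd p) ` ?P" by force
  then have "card ?N \<le> card ?P" using fin by (rule surj_card_le[rotated])
  then have "real (card ?N) \<le> (\<Sum>p\<in>?P. 1)" by simp
  also have "\<dots> \<le> (\<Sum>p\<in>?P. 2 powr K * ((1 / 2) ^ prime_Omega (fst p) * (1 / 2) ^ prime_Omega (snd p)))"
  proof (rule sum_mono)
    fix p assume p: "p \<in> ?P"
    then have pos: "fst p > 0" "snd p > 0" using smooth_set_pos by fastforce+
    have "2 powr real (prime_Omega (fst p * snd p)) \<le> 2 powr K" using p by (intro powr_mono) auto
    also have "2 powr real (prime_Omega (fst p * snd p)) = 2 ^ prime_Omega (fst p) * 2 ^ prime_Omega (snd p)"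
      using pos by (simp add: prime_Omega_mult powr_add powr_realpow)
    finally have "2 ^ prime_Omega (fst p) * 2 ^ prime_Omega (snd p) \<le> 2 powr K" .
    then show "1 \<le> 2 powr K * ((1 / 2) ^ prime_Omega (fst p) * (1 / 2) ^ prime_Omega (snd p))"
      by (simp add: power_divide field_simps)
  qed
  also have "\<dots> \<le> (\<Sum>p\<in>?S \<times> ?S. 2 powr K * ((1 / 2) ^ prime_Omega (fst p) * (1 / 2) ^ prime_Omega (snd p)))"
    by (rule sum_mono2) auto
  also have "\<dots> = 2 powr K * (half_sum X y)\<^sup>2"
    unfolding half_sum_def power2_eq_square sum_product sum.cartesian_product
    by (simp add: case_prod_unfold sum_distrib_left)
  finally show ?thesis .
qed

lemma smooth_product_count_le:
  fixes k :: nat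
  assumes "y \<ge> 1" "x \<ge> 0" "z \<le> v" "v > 1" and K: "K1 + real k + ln x / ln v \<le> K"
  shows "real (smooth_product_count x y) \<le> 2 powr K * (half_sum (sqrt x) y)\<^sup>2
    + real (card {n \<in> smooth_set x y. real (smooth_part z n) > y})
    + real (card {n \<in> smooth_set x y. real (smooth_part z n) \<le> y \<and> K1 \<le> real (prime_Omega (smooth_part z n))})
    + real (card {n \<in> smooth_set x y. k \<le> size {#p \<in># prime_factorization n. z < real p \<and> real p \<le> v#}})"
    (is "_ \<le> _ + real (card ?B) + real (card ?C) + real (card ?D)")
proof -
  let ?S = "smooth_set (sqrt x) y"
  let ?N = "{a * b | a b. a \<in> ?S \<and> b \<in> ?S}"
  let ?A = "{n \<in> ?N. real (prime_Omega n) \<le> K}"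
  have fin: "finite ?N"
  proof (rule finite_subset)
    show "?N \<subseteq> (\<lambda>(a, b). a * b) ` (?S \<times> ?S)" by auto
  qed simp
  have "?N \<subseteq> ?A \<union> ?B \<union> ?C \<union> ?D"
  proof
    fix n assume n: "n \<in> ?N"
    then have nS: "n \<in> smooth_set x y"
      using assms smooth_set_mult[of y _ "sqrt x" _ "sqrt x" x] by auto
    then have npos: "n > 0" "real n \<le> x" using smooth_set_pos by fastforce+
    show "n \<in> ?A \<union> ?B \<union> ?C \<union> ?D"
      using prime_Omega_le_parts[OF npos assms(3,4)] n nS K by fastforce
  qed
  then have "card ?N \<le> card (?A \<union> ?B \<union> ?C \<union> ?D)"
    using fin by (intro card_mono) auto
  also have "\<dots> \<le> card ?A + card ?B + card ?C + card ?D"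
    by (meson add_mono card_Un_le le_refl order_trans)
  finally have "real (smooth_product_count x y) \<le> real (card ?A) + real (card ?B) + real (card ?C) + real (card ?D)"
    unfolding smooth_product_count_def by linarith
  moreover have "real (card ?A) \<le> 2 powr K * (half_sum (sqrt x) y)\<^sup>2"
    by (rule card_products_few_factors_le[OF assms(1)])
  ultimately show ?thesis by linarith
qed

section \<open>Comparison in terms of \<open>log log y\<close>\<close>

text \<open>Because \<open>y ^ 2 <= x\<close>, dividing by \<open>(ln (sqrt x)) ^ 2\<close> gains at
  least \<open>exp (2 * t)\<close>, against one factor \<open>exp t\<close> lost in
  \<open>truncated_sum\<close>. The remaining \<open>exp (- t)\<close>, up to powers of
  \<open>t\<close>, is what \<open>2 powr K\<close> must not use up.\<close>

lemma half_sum_sqrt_square_le: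
  fixes t x C :: real
  defines "y \<equiv> exp (exp t)"
  assumes C: "C > 0" "\<And>x y. x \<ge> 1 \<Longrightarrow> y \<ge> 2 \<Longrightarrow> truncated_sum y x y \<le> (2 + C * ln x) * real (smooth_count x y)"
    and t: "t \<ge> 1" "exp t \<ge> 56" "exp t * t \<le> y"
    and x: "y\<^sup>2 \<le> x" "ln x \<le> exp t * t"
  shows "(half_sum (sqrt x) y)\<^sup>2 \<le> 49 * (2 + C * (exp t * t)) * (1 + 8 * t)\<^sup>2 / (exp t)\<^sup>2 * real (smooth_count x y)"
proof -
  \<comment> \<open>This is \<open>sqrt y\<close>: two absorption steps lead from \<open>y\<close>
    to \<open>y ^ 2\<close>, and the primes between \<open>sqrt y\<close> and \<open>y\<close> have
    reciprocal mass at least 1/4 once \<open>exp t >= 56\<close>.\<close>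
  let ?T = "exp (exp t / 2)"
  have y: "y \<ge> 2" "ln y = exp t"
    using exp_ge_add_one_self[of "exp t"] t unfolding y_def by (linarith, simp)
  have lx: "ln x \<ge> 2 * exp t" "x \<ge> 1"
  proof -
    have "y\<^sup>2 \<ge> 1" using y by simp
    with x show "x \<ge> 1" by linarith
    have "ln (y\<^sup>2) \<le> ln x" using x y by (intro ln_mono) auto
    then show "ln x \<ge> 2 * exp t" using y by (simp add: ln_realpow)
  qed
  have "1 / 4 \<le> (ln y - ln ?T - 14) / ln y" using t y by (simp add: field_simps)
  also have "\<dots> \<le> (\<Sum>q\<in>primes_between ?T y. 1 / real q)"
    using y by (intro sum_inverse_primes_ge) (auto simp: y_def)
  finally have "truncated_sum (y * ?T ^ 2) x y \<le> (2 + C * ln x) * (1 + ln x / (1 / 4 * ln ?T)) ^ 2 * real (smooth_count x y)"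
    using y lx C by (intro truncated_sum_iterate)
      (auto simp: y_def intro!: order_trans[OF C(2)] mult_right_mono add_nonneg_nonneg mult_nonneg_nonneg)
  also have "y * ?T ^ 2 = y\<^sup>2"
    by (simp add: y_def power2_eq_square flip: exp_add)
  finally have "truncated_sum (y\<^sup>2) x y \<le> (2 + C * ln x) * (1 + ln x / (1 / 4 * ln ?T)) ^ 2 * real (smooth_count x y)" .
  also have "\<dots> \<le> (2 + C * (exp t * t)) * (1 + 8 * t)\<^sup>2 * real (smooth_count x y)"
  proof (intro mult_right_mono mult_mono power_mono)
    show "1 + ln x / (1 / 4 * ln ?T) \<le> 1 + 8 * t" using x by (simp add: field_simps)
  qed (use x C lx t in auto)
  finally have W: "truncated_sum (y\<^sup>2) x y \<le> (2 + C * (exp t * t)) * (1 + 8 * t)\<^sup>2 * real (smooth_count x y)" .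
  have lsx: "ln (sqrt x) = ln x / 2" using lx by (simp add: ln_sqrt)
  have "(half_sum (sqrt x) y)\<^sup>2 * (exp t)\<^sup>2 \<le> (half_sum (sqrt x) y)\<^sup>2 * (ln (sqrt x))\<^sup>2"
    using lx lsx by (intro mult_left_mono power_mono) auto
  also have "\<dots> = (half_sum (sqrt x) y * ln (sqrt x))\<^sup>2" by (simp add: power_mult_distrib)
  also have "\<dots> \<le> 49 * truncated_sum (y\<^sup>2) ((sqrt x)\<^sup>2) y"
    using lx y x t lsx by (intro half_sum_square_le) auto
  also have "(sqrt x)\<^sup>2 = x" using lx by simp
  also have "49 * truncated_sum (y\<^sup>2) x y \<le> 49 * ((2 + C * (exp t * t)) * (1 + 8 * t)\<^sup>2 * real (smooth_count x y))"
    using W by simp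
  finally show ?thesis by (simp add: field_simps)
qed

text \<open>Products of \<open>k\<close> medium primes range up to \<open>v ^ k\<close>, so the
  truncation must be raised in \<open>s\<close> steps costing at most \<open>D * t\<close> each. As
  \<open>s\<close> is at most \<open>(1 - d / 2) * k + 1\<close>, the cost stays below Rankin's gain
  \<open>l ^ k\<close>. The quotient is about \<open>t powr (- d * k / 4)\<close> with
  \<open>k\<close> about \<open>d * t\<close>, which beats every fixed power of
  \<open>exp t\<close>.\<close>

lemma card_medium_le:
  fixes d t x C :: real
  defines "y \<equiv> exp (exp t)" and "D \<equiv> 1 + 6 / d"
  assumes C: "C > 0" "\<And>x y. x \<ge> 1 \<Longrightarrow> y \<ge> 2 \<Longrightarrow> truncated_sum y x y \<le> (2 + C * ln x) * real (smooth_count x y)"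
    and d: "0 < d" "d \<le> 1 / 2"
    and t: "t \<ge> 1" "exp t \<ge> 56 / d" "exp t \<ge> 560 * t" "2 * t \<le> exp (exp t / (10 * t))" "D * t powr (- d / 4) \<le> 1"
    and x: "1 \<le> x" "ln x \<le> exp t * t"
  shows "real (card {n \<in> smooth_set x y. nat \<lceil>d * t\<rceil> \<le> size {#p \<in># prime_factorization n.
      exp (exp t / (10 * t)) < real p \<and> real p \<le> exp ((1 - d) * exp t)#}}) \<le>
    (2 + C * (t * exp t)) * (D * t) * (D * t powr (- d / 4)) powr (d * t) *
      exp (2 * t powr (1 - d / 4) * (ln (10 * t) + 1)) * real (smooth_count x y)"
proof -
  define k where "k = nat \<lceil>d * t\<rceil>"
  define z where "z = exp (exp t / (10 * t))"
  define v where "v = exp ((1 - d) * exp t)"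
  \<comment> \<open>Strictly between \<open>1 - d\<close> and 1: below 1 so that the primes between
    \<open>T = y powr g\<close> and \<open>y\<close> keep a positive reciprocal mass, and above
    \<open>1 - d\<close> so that a proportion less than 1 of \<open>k\<close> steps reaches
    \<open>v ^ k\<close>.\<close>
  define g where "g = 1 - d / 2"
  define T where "T = exp (g * exp t)"
  define s where "s = nat \<lceil>(1 - d) * real k / g\<rceil>"
  \<comment> \<open>The exponent lies between \<open>1 - d / 2\<close> and 1. Exceeding the former
    makes \<open>l ^ k\<close> outgrow \<open>t ^ s\<close>; staying below 1 keeps
    \<open>exp (2 * l * (ln (10 * t) + 1))\<close> of size \<open>exp (o(t))\<close>.\<close>
  define l where "l = t powr (1 - d / 4)"
  have y: "y \<ge> 2" "ln y = exp t"
  proof -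
    show "y \<ge> 2" using exp_ge_add_one_self[of "exp t"] t exp_ge_add_one_self[of t] unfolding y_def by linarith
  qed (simp add: y_def)
  have g: "3 / 4 \<le> g" "g < 1" using d by (auto simp: g_def)
  have D: "D \<ge> 1" using d by (simp add: D_def)
  have k: "d * t \<le> real k" "real k \<le> d * t + 1" using d t by (auto simp: k_def)
  have s: "(1 - d) * real k / g \<le> real s" "real s \<le> (1 - d / 2) * real k + 1"
  proof -
    have nn: "(1 - d) * real k / g \<ge> 0" using d g by simp
    then show "(1 - d) * real k / g \<le> real s" by (simp add: s_def)
    have "(1 - d) / g \<le> 1 - d / 2"
      using g by (simp add: divide_le_eq) (simp add: g_def field_simps)
    then have "(1 - d) / g * real k \<le> (1 - d / 2) * real k" by (intro mult_right_mono) auto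
    moreover have "real s \<le> (1 - d) * real k / g + 1" using nn unfolding s_def by linarith
    ultimately show "real s \<le> (1 - d / 2) * real k + 1" by simp
  qed
  have "d / 4 \<le> (ln y - ln T - 14) / ln y"
  proof -
    have "d * exp t \<ge> 56" using t d by (simp add: field_simps)
    then show ?thesis using y by (simp add: T_def g_def field_simps)
  qed
  also have "\<dots> \<le> (\<Sum>q\<in>primes_between T y. 1 / real q)"
    using y g by (intro sum_inverse_primes_ge) (auto simp: y_def T_def)
  finally have W: "truncated_sum (y * T ^ s) x y \<le> (2 + C * ln x) * (1 + ln x / (d / 4 * ln T)) ^ s * real (smooth_count x y)"
    using y x C d g by (intro truncated_sum_iterate)
      (auto simp: y_def T_def intro!: order_trans[OF C(2)] mult_right_mono add_nonneg_nonneg mult_nonneg_nonneg)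
  \<comment> \<open>The mass \<open>d / 4\<close> and \<open>g >= 3 / 4\<close> produce the constant
    \<open>16 / 3\<close>, rounded up to the 6 in \<open>D\<close>.\<close>
  have R: "1 + ln x / (d / 4 * ln T) \<le> D * t"
  proof -
    have "ln x / (d / 4 * ln T) \<le> (exp t * t) / (d / 4 * ((3 / 4) * exp t))"
      using x d g t by (intro frac_le mult_left_mono mult_right_mono) (auto simp: T_def)
    also have "\<dots> = 16 / 3 * t / d" using d by (simp add: field_simps)
    also have "\<dots> \<le> 6 / d * t" using d t by (simp add: field_simps)
    finally show ?thesis using t by (simp add: D_def algebra_simps)
  qed
  define M where "M = (2 + C * (exp t * t)) * (D * t) ^ s"
  have M: "truncated_sum (y * T ^ s) x y \<le> M * real (smooth_count x y)"
  proof -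
    have "(2 + C * ln x) * (1 + ln x / (d / 4 * ln T)) ^ s \<le> M"
      unfolding M_def using C d g x R t by (intro mult_mono power_mono add_mono) (auto simp: T_def)
    then show ?thesis using W by (meson mult_right_mono of_nat_0_le_iff order_trans)
  qed
  have vB: "v ^ k \<le> y * T ^ s"
  proof -
    have "(1 - d) * real k \<le> g * real s" using s(1) g by (simp add: field_simps)
    then have "(1 - d) * real k * exp t \<le> g * real s * exp t" by (intro mult_right_mono) auto
    then have "real k * ((1 - d) * exp t) \<le> exp t + real s * (g * exp t)"
      by (smt (verit) exp_gt_zero mult.assoc mult.commute)
    then show ?thesis by (simp add: v_def y_def T_def flip: exp_of_nat_mult exp_add)
  qed
  have l: "l > 0" "l \<le> t"
    using t d powr_mono[of "1 - d / 4" 1 t] by (auto simp: l_def)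
  have N: "real (card {n \<in> smooth_set x y. k \<le> size {#p \<in># prime_factorization n. z < real p \<and> real p \<le> v#}})
     \<le> M * real (smooth_count x y) * (exp (2 * l * (\<Sum>p\<in>primes_between z v. 1 / real p)) / l ^ k)"
  proof (rule card_many_medium_primes_le[OF _ _ l(1) _ vB _ M])
    show "2 * l \<le> z" using l t by (simp add: z_def)
    show "v \<le> y" "1 \<le> v" using d by (auto simp: v_def y_def)
  qed (use y in auto)
  have S: "(\<Sum>p\<in>primes_between z v. 1 / real p) \<le> ln (10 * t) + 1"
  proof -
    have lz: "ln z = exp t / (10 * t)" "56 \<le> ln z" using t by (auto simp: z_def field_simps)
    have "exp (ln z) = z" by (simp add: z_def)
    then have zpos: "z \<ge> 2" using exp_ge_add_one_self[of "ln z"] lz(2) by linarith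
    have "(\<Sum>p\<in>primes_between z v. 1 / real p) \<le> (\<Sum>p\<in>primes_between z y. 1 / real p)"
    proof (rule sum_mono2)
      show "primes_between z v \<subseteq> primes_between z y" using d by (auto simp: primes_between_def v_def y_def intro: order_trans)
    qed auto
    also have "\<dots> \<le> ln (ln y) - ln (ln z) + 30 / ln z"
    proof (rule sum_inverse_primes_le[OF zpos])
      have "exp t / (10 * t) \<le> exp t" using t by (simp add: field_simps)
      then show "z \<le> y" by (simp add: z_def y_def)
    qed
    also have "ln (ln y) - ln (ln z) = ln (10 * t)" using t by (simp add: y lz ln_div)
    also have "30 / ln z \<le> 1"
      by (subst divide_le_eq_1_pos) (use lz(2) in linarith)+
    finally show ?thesis by simp
  qed
  have "M * (exp (2 * l * (\<Sum>p\<in>primes_between z v. 1 / real p)) / l ^ k) \<le>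
      M * (exp (2 * l * (ln (10 * t) + 1)) / l ^ k)"
    using S l t C D by (intro mult_left_mono divide_right_mono) (auto simp: M_def)
  also have "\<dots> \<le> (2 + C * (t * exp t)) * (D * t) * (D * t powr (- d / 4)) powr (d * t) * exp (2 * l * (ln (10 * t) + 1))"
  proof -
    have Dt: "D * t \<ge> 1" using D t mult_mono[of 1 D 1 t] by simp
    have "(D * t) ^ s = (D * t) powr real s" using Dt by (simp add: powr_realpow)
    also have "\<dots> \<le> (D * t) powr ((1 - d / 2) * real k + 1)" using s Dt by (intro powr_mono) auto
    also have "\<dots> = (D powr ((1 - d / 2) * real k) * t powr ((1 - d / 2) * real k)) * (D * t)"
      using Dt D t by (simp add: powr_add powr_mult)
    also have "\<dots> \<le> (D powr real k * t powr ((1 - d / 2) * real k)) * (D * t)"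
    proof (intro mult_right_mono powr_mono)
      show "(1 - d / 2) * real k \<le> real k" using d by (simp add: algebra_simps)
    qed (use D Dt in auto)
    finally have "(D * t) ^ s / l ^ k \<le> (D powr real k * t powr ((1 - d / 2) * real k)) * (D * t) / l ^ k"
      using l by (intro divide_right_mono) auto
    also have lk: "l ^ k = t powr ((1 - d / 4) * real k)"
      using t by (simp add: l_def powr_powr flip: powr_realpow)
    also have "t powr ((1 - d / 2) * real k) = t powr ((1 - d / 4) * real k) * t powr (- d / 4 * real k)"
      unfolding powr_add[symmetric] by (simp add: algebra_simps)
    also have "(D powr real k * (t powr ((1 - d / 4) * real k) * t powr (- d / 4 * real k))) * (D * t) /
        t powr ((1 - d / 4) * real k) = (D * t) * (D powr real k * t powr (- d / 4 * real k))"
      using t by simp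
    also have "D powr real k * t powr (- d / 4 * real k) = (D * t powr (- d / 4)) powr real k"
      using D t by (simp add: powr_mult powr_powr)
    also have "\<dots> \<le> (D * t powr (- d / 4)) powr (d * t)"
      using k t D by (intro powr_mono') auto
    finally have *: "(D * t) ^ s / l ^ k \<le> (D * t) * (D * t powr (- d / 4)) powr (d * t)"
      using Dt by (simp add: mult_left_mono lk)
    have "M * (exp (2 * l * (ln (10 * t) + 1)) / l ^ k) =
        (2 + C * (t * exp t)) * exp (2 * l * (ln (10 * t) + 1)) * ((D * t) ^ s / l ^ k)"
      by (simp add: M_def mult_ac)
    also have "\<dots> \<le> (2 + C * (t * exp t)) * exp (2 * l * (ln (10 * t) + 1)) * ((D * t) * (D * t powr (- d / 4)) powr (d * t))"
      using * C t by (intro mult_left_mono) auto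
    finally show ?thesis by (simp add: mult_ac)
  qed
  finally have "M * (exp (2 * l * (\<Sum>p\<in>primes_between z v. 1 / real p)) / l ^ k) * real (smooth_count x y) \<le>
    (2 + C * (t * exp t)) * (D * t) * (D * t powr (- d / 4)) powr (d * t) * exp (2 * l * (ln (10 * t) + 1)) * real (smooth_count x y)"
    by (intro mult_right_mono) auto
  with N show ?thesis
    by (simp add: k_def z_def v_def l_def mult_ac)
qed

lemma smooth_product_count_le_of_loglog:
  assumes c: "0 < c" "ln 2 * (1 + c) < 1" and \<eta>: "\<eta> > 0"
  shows "\<exists>t0. \<forall>t\<ge>t0. \<forall>x. (exp (exp t))\<^sup>2 \<le> x \<longrightarrow> ln x \<le> c * (exp t * t) \<longrightarrow>
    real (smooth_product_count x (exp (exp t))) \<le> \<eta> * real (smooth_count x (exp (exp t)))"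
proof -
  obtain C where C: "C > 0"
    "\<And>x y. x \<ge> 1 \<Longrightarrow> y \<ge> 2 \<Longrightarrow> truncated_sum y x y \<le> (2 + C * ln x) * real (smooth_count x y)"
    using truncated_sum_base by blast
  obtain C' where C': "C' \<ge> 0" "\<And>y w X K. y \<ge> 2 \<Longrightarrow> 1 \<le> w \<Longrightarrow> w \<le> 3 / 2 \<Longrightarrow> 0 \<le> X \<Longrightarrow> X \<le> y \<Longrightarrow>
     real (card {d. 1 \<le> d \<and> real d \<le> X \<and> K \<le> real (prime_Omega d)}) \<le>
       w powr (- K) * exp ((w - 1) * (ln (ln y) + C')) * X"
    using card_prime_Omega_ge_le by blast
  \<comment> \<open>The strict inequality for \<open>c\<close> leaves room for a positive
    \<open>d\<close>, which is the slack in all three ranges of primes.\<close>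
  have "((\<lambda>d. ln 2 * ((1 + 2 * d) + c / (1 - d))) \<longlongrightarrow> ln 2 * ((1 + 2 * 0) + c / (1 - 0))) (at_right 0)"
    by (intro tendsto_intros) auto
  then have "eventually (\<lambda>d. ln 2 * ((1 + 2 * d) + c / (1 - d)) < 1) (at_right 0)"
    by (rule order_tendstoD) (use c in simp)
  moreover have "eventually (\<lambda>d::real. d \<in> {0<..<1 / 2}) (at_right 0)"
    by (rule eventually_at_right_real) simp
  ultimately have "eventually (\<lambda>d. ln 2 * ((1 + 2 * d) + c / (1 - d)) < 1 \<and> d \<in> {0<..<1 / 2}) (at_right 0)"
    by (rule eventually_conj)
  then obtain d where d: "ln 2 * ((1 + 2 * d) + c / (1 - d)) < 1" "0 < d" "d < 1 / 2"
    using eventually_happens by (force simp: trivial_limit_at_right_real)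
  have c1: "c \<le> 1"
  proof -
    have "2 / 3 * (1 + c) \<le> ln 2 * (1 + c)" using ln2_ge_two_thirds c by (intro mult_right_mono) auto
    with c show ?thesis by simp
  qed
  \<comment> \<open>By this choice \<open>K * ln 2 = ln 2 + (1 - e) * t\<close>, so
    \<open>2 powr K\<close> falls short of \<open>exp t\<close> by a power of
    \<open>ln y\<close>.\<close>
  define e where "e = 1 - ln 2 * ((1 + 2 * d) + c / (1 - d))"
  \<comment> \<open>The Poisson large deviation rate at \<open>1 + d\<close>, obtained from Rankin's
    trick with \<open>w = 1 + d\<close>. It is positive because \<open>ln r < r - 1\<close> at
    \<open>r = 1 / (1 + d)\<close>.\<close>
  define e' where "e' = (1 + d) * ln (1 + d) - d"
  define D where "D = 1 + 6 / d"
  have e: "e > 0" using d by (simp add: e_def)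
  have e': "e' > 0"
  proof -
    have "ln (1 / (1 + d)) \<noteq> 1 / (1 + d) - 1"
      using d ln_eq_minus_one[of "1 / (1 + d)"] by auto
    moreover have "ln (1 / (1 + d)) \<le> 1 / (1 + d) - 1" using d by (intro ln_le_minus_one) auto
    ultimately have "- ln (1 + d) < 1 / (1 + d) - 1" using d by (simp add: ln_div)
    then have "(1 + d) * (1 - 1 / (1 + d)) < (1 + d) * ln (1 + d)" using d by (intro mult_strict_left_mono) auto
    moreover have "(1 + d) * (1 - 1 / (1 + d)) = d" using d by (simp add: field_simps)
    ultimately show ?thesis by (simp add: e'_def)
  qed
  have D: "D > 0" using d by (simp add: D_def add_pos_pos)
  define g1 where "g1 t = 98 * exp (- e * t) * (2 + C * t) * (1 + 8 * t)\<^sup>2" for t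
  define g2 where "g2 t = exp (- 3 * t) * (exp ((1 / 2) * (t + C')) * (2 + C * (t * exp t)))" for t
  define g3 where "g3 t = exp (- e' * t) * exp (d * C') * (2 + 1600 * t ^ 3)" for t :: real
  \<comment> \<open>The decisive factor has size
    \<open>exp (- (d ^ 2 / 4) * t * ln t + O(t))\<close>; the others together are only
    \<open>exp (O(t))\<close>.\<close>
  define g4 where "g4 t = (2 + C * (t * exp t)) * (D * t) * (D * t powr (- d / 4)) powr (d * t) *
      exp (2 * t powr (1 - d / 4) * (ln (10 * t) + 1))" for t
  have "(g1 \<longlongrightarrow> 0) at_top" unfolding g1_def using C(1) e by real_asymp
  moreover have "(g2 \<longlongrightarrow> 0) at_top" unfolding g2_def using C(1) by real_asymp
  moreover have "(g3 \<longlongrightarrow> 0) at_top" unfolding g3_def using e' by real_asymp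
  moreover have "(g4 \<longlongrightarrow> 0) at_top" unfolding g4_def using C(1) d(2,3) D by real_asymp
  ultimately have lim: "(g1 \<longlongrightarrow> 0) at_top" "(g2 \<longlongrightarrow> 0) at_top" "(g3 \<longlongrightarrow> 0) at_top" "(g4 \<longlongrightarrow> 0) at_top"
    by auto
  have "\<eta> / 4 > 0" using \<eta> by simp
  note ev = lim[THEN order_tendstoD(2), OF this]
  have "((\<lambda>t::real. D * t powr (- d / 4)) \<longlongrightarrow> 0) at_top" using D d by real_asymp
  then have "eventually (\<lambda>t::real. D * t powr (- d / 4) < 1) at_top" by (rule order_tendstoD) simp
  then have ev5: "eventually (\<lambda>t::real. D * t powr (- d / 4) \<le> 1) at_top" by eventually_elim simp
  have "filterlim (\<lambda>t::real. exp t) at_top at_top" by real_asymp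
  then have ev6: "eventually (\<lambda>t::real. exp t \<ge> 56 / d) at_top" by (simp add: filterlim_at_top)
  have ev7: "eventually (\<lambda>t::real. exp t \<ge> 560 * t) at_top" "eventually (\<lambda>t::real. exp t * t \<le> exp (exp t)) at_top"
    "eventually (\<lambda>t::real. 2 * t \<le> exp (exp t / (10 * t))) at_top" "eventually (\<lambda>t::real. t \<ge> 1) at_top"
    by real_asymp+
  have "eventually (\<lambda>t. \<forall>x. (exp (exp t))\<^sup>2 \<le> x \<longrightarrow> ln x \<le> c * (exp t * t) \<longrightarrow>
    real (smooth_product_count x (exp (exp t))) \<le> \<eta> * real (smooth_count x (exp (exp t)))) at_top"
    using ev ev5 ev6 ev7
  proof (eventually_elim, intro allI impI)
    fix t x :: real
    assume g: "g1 t < \<eta> / 4" "g2 t < \<eta> / 4" "g3 t < \<eta> / 4" "g4 t < \<eta> / 4"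
      and t5: "D * t powr (- d / 4) \<le> 1" and t6: "exp t \<ge> 56 / d"
      and t7: "exp t \<ge> 560 * t" "exp t * t \<le> exp (exp t)" "2 * t \<le> exp (exp t / (10 * t))" "t \<ge> 1"
      and x: "(exp (exp t))\<^sup>2 \<le> x" "ln x \<le> c * (exp t * t)"
    define y where "y = exp (exp t)"
    define z where "z = exp (exp t / (10 * t))"
    define v where "v = exp ((1 - d) * exp t)"
    define k where "k = nat \<lceil>d * t\<rceil>"
    \<comment> \<open>Fewer than \<open>(1 + d) * t\<close> small prime factors, fewer than
      \<open>k <= d * t + 1\<close> medium ones, and at most
      \<open>ln x / ln v <= c * t / (1 - d)\<close> large ones.\<close>
    define K where "K = (1 + 2 * d) * t + 1 + c * t / (1 - d)"
    let ?P = "real (smooth_count x y)"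
    have y: "y \<ge> 2" "ln y = exp t"
      using exp_ge_add_one_self[of "exp t"] t7 unfolding y_def by (linarith, simp)
    have x1: "x \<ge> 1" "ln x \<ge> 0"
    proof -
      have "y\<^sup>2 \<ge> 1" using y by simp
      then show "x \<ge> 1" using x(1) unfolding y_def by linarith
      then show "ln x \<ge> 0" by simp
    qed
    have x2: "ln x \<le> exp t * t"
    proof -
      have "c * (exp t * t) \<le> 1 * (exp t * t)" using c1 t7 by (intro mult_right_mono) auto
      with x(2) show ?thesis by linarith
    qed
    have lz: "ln z = exp t / (10 * t)" "56 \<le> ln z" using t7 by (auto simp: z_def field_simps)
    have z1: "z > 1" using lz by (simp add: z_def)
    have zv: "z \<le> v"
    proof -
      have "exp t / (10 * t) \<le> exp t * (1 / 2)" using t7 by (simp add: field_simps)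
      also have "\<dots> \<le> exp t * (1 - d)" using d by (intro mult_left_mono) auto
      finally show ?thesis by (simp add: z_def v_def mult.commute)
    qed
    have v: "v > 1" "v \<le> y" using d by (auto simp: v_def y_def)
    have "real (smooth_product_count x y) \<le> 2 powr K * (half_sum (sqrt x) y)\<^sup>2
      + real (card {n \<in> smooth_set x y. real (smooth_part z n) > y})
      + real (card {n \<in> smooth_set x y. real (smooth_part z n) \<le> y \<and> (1 + d) * t \<le> real (prime_Omega (smooth_part z n))})
      + real (card {n \<in> smooth_set x y. k \<le> size {#p \<in># prime_factorization n. z < real p \<and> real p \<le> v#}})"
    proof (rule smooth_product_count_le[OF _ _ zv v(1)])
      have "real k \<le> d * t + 1" using d t7 unfolding k_def by (simp add: ceiling_le_iff)
      moreover have "ln x / ln v \<le> c * (exp t * t) / ln v"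
        using x(2) v(1) by (intro divide_right_mono) auto
      moreover have "c * (exp t * t) / ln v = c * t / (1 - d)"
        using d by (simp add: v_def)
      ultimately show "(1 + d) * t + real k + ln x / ln v \<le> K" by (simp add: K_def algebra_simps)
    qed (use y x1 in auto)
    also have "2 powr K * (half_sum (sqrt x) y)\<^sup>2 \<le> g1 t * ?P"
    proof -
      have "(half_sum (sqrt x) y)\<^sup>2 \<le> 49 * (2 + C * (exp t * t)) * (1 + 8 * t)\<^sup>2 / (exp t)\<^sup>2 * ?P"
        unfolding y_def using C t7 x x2 by (intro half_sum_sqrt_square_le) auto
      also have "\<dots> \<le> 49 * (exp t * (2 + C * t)) * (1 + 8 * t)\<^sup>2 / (exp t)\<^sup>2 * ?P"
        using t7 by (intro mult_right_mono divide_right_mono mult_left_mono) (auto simp: algebra_simps)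
      finally have "2 powr K * (half_sum (sqrt x) y)\<^sup>2 \<le>
          2 powr K * (49 * (exp t * (2 + C * t)) * (1 + 8 * t)\<^sup>2 / (exp t)\<^sup>2 * ?P)"
        by (intro mult_left_mono) auto
      also have "\<dots> = g1 t * ?P"
      proof -
        have "K * ln 2 = ln 2 + (t + - e * t)" by (simp add: K_def e_def algebra_simps)
        then have "2 powr K = exp (ln 2 + (t + - e * t))" by (simp add: powr_def)
        also have "\<dots> = 2 * (exp t * exp (- e * t))" unfolding exp_add by simp
        finally show ?thesis by (simp add: g1_def power2_eq_square mult_ac)
      qed
      finally show ?thesis .
    qed
    also have "real (card {n \<in> smooth_set x y. real (smooth_part z n) > y}) \<le> g2 t * ?P"
    proof -
      \<comment> \<open>The 10 in \<open>z\<close> is chosen for this place: with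
        \<open>w = 3 / 2\<close> these prime factors save \<open>exp (3 * t)\<close>, against losses
        of order \<open>exp (t / 2)\<close> and \<open>t * exp t\<close>.\<close>
      have K2: "(ln y - ln z) / ln z = 10 * t - 1" using t7 by (simp add: y lz field_simps)
      have "real (card {n \<in> smooth_set x y. real (smooth_part z n) > y}) \<le>
          (3 / 2) powr (- (10 * t - 1)) * exp ((3 / 2 - 1) * (ln (ln y) + C')) * truncated_sum y x y"
      proof (rule card_large_smooth_part_le)
        fix X assume "0 \<le> X" "X \<le> y"
        then show "real (card {d. 1 \<le> d \<and> real d \<le> X \<and> (ln y - ln z) / ln z \<le> real (prime_Omega d)}) \<le>
            (3 / 2) powr (- (10 * t - 1)) * exp ((3 / 2 - 1) * (ln (ln y) + C')) * X"
          unfolding K2 using y by (intro C'(2)) auto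
      qed (use y x1 z1 in auto)
      also have "\<dots> \<le> (3 / 2) powr (- (10 * t - 1)) * exp ((3 / 2 - 1) * (ln (ln y) + C')) * ((2 + C * (exp t * t)) * ?P)"
      proof (rule mult_left_mono)
        have "truncated_sum y x y \<le> (2 + C * ln x) * ?P" using C x1 y by blast
        also have "\<dots> \<le> (2 + C * (exp t * t)) * ?P" using C x2 by (intro mult_right_mono) auto
        finally show "truncated_sum y x y \<le> (2 + C * (exp t * t)) * ?P" .
      qed auto
      also have "\<dots> = (3 / 2) powr (1 - 10 * t) * (exp ((1 / 2) * (t + C')) * (2 + C * (t * exp t)) * ?P)"
        by (simp add: y mult_ac)
      also have "\<dots> \<le> exp (- 3 * t) * (exp ((1 / 2) * (t + C')) * (2 + C * (t * exp t)) * ?P)"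
      proof (intro mult_right_mono)
        have "ln (2 / 3 :: real) \<le> 2 / 3 - 1" by (intro ln_le_minus_one) auto
        then have "ln (3 / 2 :: real) \<ge> 1 / 3" by (simp add: ln_div)
        then have "(1 - 10 * t) * ln (3 / 2) \<le> (1 - 10 * t) * (1 / 3)"
          using t7 by (intro mult_left_mono_neg) auto
        also have "\<dots> \<le> - 3 * t" using t7 by simp
        finally show "(3 / 2) powr (1 - 10 * t) \<le> exp (- 3 * t)" by (simp add: powr_def)
      qed (use C t7 in auto)
      finally show ?thesis by (simp add: g2_def mult_ac)
    qed
    also have "real (card {n \<in> smooth_set x y. real (smooth_part z n) \<le> y \<and> (1 + d) * t \<le> real (prime_Omega (smooth_part z n))})
        \<le> g3 t * ?P"
    proof -
      have "real (card {n \<in> smooth_set x y. real (smooth_part z n) \<le> y \<and> (1 + d) * t \<le> real (prime_Omega (smooth_part z n))})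
          \<le> (1 + d) powr (- ((1 + d) * t)) * exp ((1 + d - 1) * (ln (ln y) + C')) * rough_sum z y x y"
        using y x1 d by (intro card_smooth_part_many_factors_le C'(2)) auto
      also have "(1 + d) powr (- ((1 + d) * t)) * exp ((1 + d - 1) * (ln (ln y) + C')) = exp (- e' * t) * exp (d * C')"
        using d by (simp add: powr_def e'_def y algebra_simps flip: exp_add)
      also have "rough_sum z y x y \<le> (2 + 16 * ln y * ln x / (ln z)\<^sup>2) * ?P"
        using lz z1 zv v x1 by (intro rough_sum_le) auto
      also have "(2 + 16 * ln y * ln x / (ln z)\<^sup>2) * ?P \<le> (2 + 1600 * t ^ 3) * ?P"
      proof (intro mult_right_mono add_left_mono)
        have "16 * ln y * ln x / (ln z)\<^sup>2 \<le> 16 * ln y * (exp t * t) / (ln z)\<^sup>2"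
          using x2 y by (intro divide_right_mono mult_left_mono) auto
        also have "\<dots> = 1600 * t ^ 3"
          using t7 by (simp add: y lz power2_eq_square power3_eq_cube field_simps)
        finally show "16 * ln y * ln x / (ln z)\<^sup>2 \<le> 1600 * t ^ 3" .
      qed auto
      finally show ?thesis by (simp add: g3_def mult_left_mono mult_ac)
    qed
    also have "real (card {n \<in> smooth_set x y. k \<le> size {#p \<in># prime_factorization n. z < real p \<and> real p \<le> v#}})
        \<le> g4 t * ?P"
      unfolding g4_def D_def k_def z_def v_def y_def
      using C d t5 t6 t7 x1 x2 by (intro card_medium_le) (auto simp: D_def)
    finally have "real (smooth_product_count x y) \<le> (g1 t + g2 t + g3 t + g4 t) * ?P"
      by (simp add: algebra_simps)
    also have "\<dots> \<le> \<eta> * ?P" using g by (intro mult_right_mono) auto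
    finally show "real (smooth_product_count x (exp (exp t))) \<le> \<eta> * real (smooth_count x (exp (exp t)))"
      by (simp add: y_def)
  qed
  then show ?thesis by (simp add: eventually_at_top_linorder)
qed

section \<open>Reduction to \<open>y <= sqrt x\<close> and conclusion\<close>

lemma smooth_set_min: "x \<ge> 1 \<Longrightarrow> y \<ge> 1 \<Longrightarrow> smooth_set x (min y x) = smooth_set x y"
  by (auto simp: smooth_set_iff dest!: dvd_imp_le)

theorem theorem1p3:
  fixes \<epsilon> :: real
  assumes "\<epsilon> > 0"
  shows "((\<lambda>(x, y). real (smooth_product_count x y) / real (smooth_count x y)) \<longlongrightarrow> 0)
           (smooth_range \<epsilon>)"
proof (rule tendstoI)
  fix \<eta> :: real assume \<eta>: "\<eta> > 0"
  have L: "critical_const > 0" "ln 2 * (1 + critical_const) = 1"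
    using ln_2_less_1 by (auto simp: critical_const_def field_simps)
  define c where "c = max (critical_const - \<epsilon>) (critical_const / 2)"
  have c: "0 < c" "c < critical_const" "critical_const - \<epsilon> \<le> c"
    using L assms by (auto simp: c_def)
  have "ln 2 * (1 + c) < ln 2 * (1 + critical_const)" using c by (intro mult_strict_left_mono) auto
  with L have c2: "ln 2 * (1 + c) < 1" by simp
  obtain t0 where t0: "\<And>t x. t \<ge> t0 \<Longrightarrow> (exp (exp t))\<^sup>2 \<le> x \<Longrightarrow> ln x \<le> c * (exp t * t) \<Longrightarrow>
    real (smooth_product_count x (exp (exp t))) \<le> \<eta> / 2 * real (smooth_count x (exp (exp t)))"
    using smooth_product_count_le_of_loglog[OF c(1) c2, of "\<eta> / 2"] \<eta> by auto
  \<comment> \<open>The bound \<open>2 / c\<close> ensures \<open>2 <= c * t\<close>, which covers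
    the case in which \<open>y\<close> is replaced by \<open>sqrt x\<close>.\<close>
  define t1 where "t1 = max t0 (max 0 (2 / c))"
  define N where "N = exp (exp t1)"
  have N: "N > 1" by (simp add: N_def)
  have key: "real (smooth_product_count x y) \<le> \<eta> / 2 * real (smooth_count x y)"
    if x: "x \<ge> N\<^sup>2" and y: "y \<ge> N" and r: "ln x / ln y < (critical_const - \<epsilon>) * ln (ln y)" for x y
  proof -
    have x1: "x > 1" using x one_less_power[OF N, of 2] by linarith
    have sx: "sqrt x \<ge> N" using x by (rule real_le_rsqrt)
    \<comment> \<open>Elements of \<open>smooth_set (sqrt x) y\<close> have no prime above
      \<open>sqrt x\<close>, so lowering \<open>y\<close> to \<open>y'\<close> leaves the product
      set unchanged and can only decrease \<open>smooth_count x y\<close>. This secures the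
      hypothesis \<open>y' ^ 2 <= x\<close>.\<close>
    define y' where "y' = min y (sqrt x)"
    define t where "t = ln (ln y')"
    have "y' \<ge> N" using y sx by (simp add: y'_def)
    with N have y': "y' \<ge> N" "y' > 1" by linarith+
    have ly: "ln y' \<ge> exp t1" using y' N ln_mono[of N y'] by (simp add: N_def)
    then have lpos: "ln y' > 0" using exp_gt_zero[of t1] by linarith
    have yt: "exp (exp t) = y'" using lpos y' by (simp add: t_def)
    have t: "t \<ge> t1" using ly lpos ln_mono[of "exp t1" "ln y'"] by (simp add: t_def)
    have t_nonneg: "t \<ge> 0" using t by (simp add: t1_def)
    have "y'\<^sup>2 \<le> (sqrt x)\<^sup>2" using y' by (intro power_mono) (auto simp: y'_def)
    then have x2: "y'\<^sup>2 \<le> x" using x1 by simp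
    have "ln x \<le> c * (ln y' * t)"
    proof (cases "y \<le> sqrt x")
      case True
      then have eq: "y' = y" by (simp add: y'_def)
      have "ln x < (critical_const - \<epsilon>) * t * ln y'"
        using r lpos by (simp add: eq t_def field_simps)
      also have "\<dots> \<le> c * t * ln y'"
        using c t_nonneg lpos by (intro mult_right_mono) auto
      finally show ?thesis by (simp add: mult_ac)
    next
      case False
      \<comment> \<open>With \<open>y'\<close> in place of \<open>y\<close> the ratio
        \<open>u\<close> is exactly 2, so the range condition follows from the size of
        \<open>t\<close> instead of from \<open>r\<close>.\<close>
      then have "y' = sqrt x" by (simp add: y'_def)
      then have "ln x = 2 * ln y'" using x1 by (simp add: ln_sqrt)
      also have "\<dots> \<le> (c * t) * ln y'"
        using t c lpos by (intro mult_right_mono) (auto simp: t1_def field_simps)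
      finally show ?thesis by (simp add: mult_ac)
    qed
    then have "real (smooth_product_count x y') \<le> \<eta> / 2 * real (smooth_count x y')"
      using t0[of t x] t x2 lpos by (simp add: yt t1_def) (simp add: t_def)
    also have "smooth_product_count x y' = smooth_product_count x y"
      using smooth_set_min[of "sqrt x" y] x1 y N by (simp add: smooth_product_count_def y'_def)
    also have "\<eta> / 2 * real (smooth_count x y') \<le> \<eta> / 2 * real (smooth_count x y)"
      using \<eta> by (intro mult_left_mono of_nat_mono smooth_count_mono) (auto simp: y'_def)
    finally show ?thesis .
  qed
  have "eventually (\<lambda>p. fst p \<ge> N\<^sup>2 \<and> snd p \<ge> N) (at_top \<times>\<^sub>F at_top :: (real \<times> real) filter)"
    by (intro eventually_prodI eventually_ge_at_top)
  then have "eventually (\<lambda>p. p \<in> {(x, y). ln x / ln y < (critical_const - \<epsilon>) * ln (ln y)} \<longrightarrow>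
      dist (case p of (x, y) \<Rightarrow> real (smooth_product_count x y) / real (smooth_count x y)) 0 < \<eta>)
    (at_top \<times>\<^sub>F at_top)"
  proof eventually_elim
    case (elim p)
    obtain x y where p: "p = (x, y)" by fastforce
    show ?case
    proof
      assume r: "p \<in> {(x, y). ln x / ln y < (critical_const - \<epsilon>) * ln (ln y)}"
      have "x \<ge> N\<^sup>2" "y \<ge> N" using elim p by auto
      then have xy: "x \<ge> 1" "y \<ge> 1" using N one_less_power[OF N, of 2] by linarith+
      have pos: "real (smooth_count x y) > 0" using smooth_count_pos[OF xy] by simp
      have "real (smooth_product_count x y) / real (smooth_count x y) \<le> \<eta> / 2"
        using key[of x y] elim r p pos by (simp add: divide_le_eq)
      with \<eta> have "real (smooth_product_count x y) / real (smooth_count x y) < \<eta>" by linarith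
      then show "dist (case p of (x, y) \<Rightarrow> real (smooth_product_count x y) / real (smooth_count x y)) 0 < \<eta>"
        using p by simp
    qed
  qed
  then show "eventually (\<lambda>p. dist (case p of (x, y) \<Rightarrow> real (smooth_product_count x y) / real (smooth_count x y)) 0 < \<eta>) (smooth_range \<epsilon>)"
    unfolding smooth_range_def eventually_inf_principal .
qed

end
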